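(* Let $p_{-1},p_1,p_{-1,1}\ge0$ with $p_{-1}+p_1+p_{-1,1}=1$, and consider a random Dyck N-walk of length $2n$ whose N-steps are chosen independently, $\{-1\},\{1\},\{-1,1\}$ with probabilities $p_{-1},p_1,p_{-1,1}$. As $n\to\infty$, the probability that it is an N-excursion has the following asymptotic form, where the roles of $p_{-1}$ and $p_1$ are interchangeable: 1. $\frac{(1-2p_1)(1-2p_{-1})}{(1-p_1)(1-p_{-1})}+\mathcal O\!\left(\frac{(4p_{-1}(1-p_{-1}))^n}{n^{3/2}}\right)$ if $0\le p_1\le p_{-1}<\frac12$; 2. $\frac{1-2p_1}{(1-p_1)\sqrt{\pi n}}+\mathcal O(n^{-3/2})$ if $0\le p_1<\frac12$ and $p_{-1}=\frac12$; 3. $\frac{1}{\sqrt{\pi n^3}}+\mathcal O(n^{-5/2})$ if $p_1=p_{-1}=\frac12$; 4. $\gamma\frac{(4p_{-1}(1-p_{-1}))^n}{\sqrt{n^3}}+\mathcal O\!\left(\frac{(4p_{-1}(1-p_{-1}))^n}{n^{5/2}}\right)$ if $0\le p_1<\frac12<p_{-1}<1$ and $p_{-1}+p_1\le1$, where $\gamma=\frac1{\sqrt\pi}$ if $p_{-1}+p_1=1$, and $$\gamma=\frac{2p_{-1}}{\sqrt\pi}\cdot\frac{\sqrt{p_{-1,1}p_{-1}(1-p_{-1})(p_{-1}-p_1)}-p_{-1}(1-p_{-1})+(1-p_1)/2}{(1-p_1)(2p_{-1}-1)^2}\quad\text{if }p_{-1}+p_1<1.$$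
   Context: An N-step is a non-empty finite set of integers. Dyck N-walks are finite sequences $(s_1,\dots,s_n)$ of N-steps from $\{\{-1\},\{1\},\{-1,1\}\}$, starting at $0$. A classical walk $(v_1,\dots,v_n)$ of integers with positions $\omega_k=\sum_{i\le k}v_i$ is compatible with the N-walk if $v_i\in s_i$ for all $i$; it is an excursion if $\omega_k\ge 0$ for all $k$ and $\omega_n=0$. A Dyck N-excursion is a Dyck N-walk compatible with at least one excursion. *)

theory Defs
  imports "HOL-Probability.Probability" "HOL-Library.Landau_Symbols"
begin

definition Dyck_N_steps :: "int set set" where
  "Dyck_N_steps = {{-1}, {1}, {-1, 1}}"

definition Dyck_N_walk :: "int set list \<Rightarrow> bool" where
  "Dyck_N_walk w \<longleftrightarrow> set w \<subseteq> Dyck_N_steps"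

definition compatible :: "int list \<Rightarrow> int set list \<Rightarrow> bool" where
  "compatible v w \<longleftrightarrow> list_all2 (\<in>) v w"

(* A classical walk is given by its list of steps; sum_list (take k v) is its position after k steps. *)
definition excursion :: "int list \<Rightarrow> bool" where
  "excursion v \<longleftrightarrow> (\<forall>k\<le>length v. 0 \<le> sum_list (take k v)) \<and> sum_list v = 0"

definition Dyck_N_excursion :: "int set list \<Rightarrow> bool" where
  "Dyck_N_excursion w \<longleftrightarrow> Dyck_N_walk w \<and> (\<exists>v. compatible v w \<and> excursion v)"

(* The arguments are the probabilities of {-1}, {1} and {-1,1}, in this order.  pmf_of_list is
   only meaningful when they are nonnegative and sum to 1. *)
definition Dyck_N_step_pmf :: "real \<Rightarrow> real \<Rightarrow> real \<Rightarrow> int set pmf" where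
  "Dyck_N_step_pmf p_minus p_plus p_both =
     pmf_of_list [({-1}, p_minus), ({1}, p_plus), ({-1, 1}, p_both)]"

lemma pmf_Dyck_N_step_pmf:
  assumes "p_minus \<ge> 0" "p_plus \<ge> 0" "p_both \<ge> 0" "p_minus + p_plus + p_both = 1"
  shows "pmf (Dyck_N_step_pmf p_minus p_plus p_both) {-1} = p_minus"
    and "pmf (Dyck_N_step_pmf p_minus p_plus p_both) {1} = p_plus"
    and "pmf (Dyck_N_step_pmf p_minus p_plus p_both) {-1, 1} = p_both"
proof -
  have wf: "pmf_of_list_wf [({-1::int}, p_minus), ({1}, p_plus), ({-1, 1}, p_both)]"
    using assms by (auto simp: pmf_of_list_wf_def)
  have ne: "{-1::int, 1} \<noteq> {-1}" "{-1::int, 1} \<noteq> {1}" "{-1::int} \<noteq> {1}"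
    by auto
  show "pmf (Dyck_N_step_pmf p_minus p_plus p_both) {-1} = p_minus"
    "pmf (Dyck_N_step_pmf p_minus p_plus p_both) {1} = p_plus"
    "pmf (Dyck_N_step_pmf p_minus p_plus p_both) {-1, 1} = p_both"
    unfolding Dyck_N_step_pmf_def pmf_pmf_of_list[OF wf]
    using ne ne[symmetric] by simp_all
qed

definition prob_Dyck_N_excursion :: "real \<Rightarrow> real \<Rightarrow> real \<Rightarrow> nat \<Rightarrow> real" where
  "prob_Dyck_N_excursion p_minus p_plus p_both m =
     measure_pmf.prob (replicate_pmf m (Dyck_N_step_pmf p_minus p_plus p_both))
       {w. Dyck_N_excursion w}"

(* The constant of the regime a > 1/2, where a is the probability of the more likely of the two
   singleton steps, b that of the other one and c that of {-1,1}. *)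
definition Dyck_N_gamma :: "real \<Rightarrow> real \<Rightarrow> real \<Rightarrow> real" where
  "Dyck_N_gamma a b c =
     (if a + b = 1 then 1 / sqrt pi
      else 2 * a / sqrt pi *
        ((sqrt (c * a * (1 - a) * (a - b)) - a * (1 - a) + (1 - b) / 2) /
         ((1 - b) * (2 * a - 1)\<^sup>2)))"

end

(*
A word of even length over {-1}, {1}, {-1,1} admits an excursion iff reading every {-1,1} as 1 keeps
all prefix sums nonnegative and reading every {-1,1} as -1 keeps all suffix sums nonpositive.  Under
the random model the two readings are simple walks (the second one backwards), and the shortest bad
prefix and the shortest bad suffix never overlap, hence are independent.  With f, g the first-passage
weights to -1 of the two walks, inclusion-exclusion writes the probability as
  1 - sum_{i<n} f i - sum_{i<n} g i + sum_{i+j<n} f i * g j,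
and f i = q * C_i * (q (1 - q))^i with the Catalan numbers C_i.  The asymptotics follow by completing
the sums, whose values are 2q / (1 + |1 - 2q|): the tails are geometric times C_i / 4^i, which is
1 / sqrt (pi i^3) + O(i^(-5/2)) by Wallis' product, and the convolution is treated by taking the slowly
varying factor out of the sum.
*)

theory Submission
  imports Defs "HOL-Real_Asymp.Real_Asymp"
begin

section \<open>Reduction to two simple walks\<close>

text \<open>In each regime \<open>a\<close> is the larger singleton probability and \<open>b\<close>
  the other. If \<open>a \<ge> 1/2\<close>, the reading that goes down with probability
  \<open>a\<close> reaches -1 almost surely, the completed sums contribute nothing, and what remains
  is the tail of the \<open>a\<close>-series minus its convolution with the
  \<open>b\<close>-weights. That convolution is the obstacle. It behaves like the sum of the weights
  times the tail as long as the \<open>b\<close>-weights, measured against the exponential rate of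
  the tail, decay geometrically, that is, as long as \<open>b * (1 - b) < a * (1 - a)\<close>. Since
  \<open>a * (1 - a) - b * (1 - b) = (a - b) * (1 - a - b)\<close>, this fails for
  \<open>a \<ge> 1/2\<close> exactly when \<open>a + b = 1\<close>. Then both ends of the
  convolution matter, and for \<open>a = b = 1/2\<close> the leading terms even cancel. But
  \<open>a + b = 1\<close> means that \<open>{-1, 1}\<close> has probability 0, so the N-walk is an
  ordinary walk and its probability is known exactly. The same factorisation produces the square
  root in \<open>Dyck_N_gamma\<close>: it is the root in the Catalan generating function, evaluated
  at the ratio of \<open>b * (1 - b)\<close> to \<open>a * (1 - a)\<close>.\<close>

definition stays_nonneg :: "int list \<Rightarrow> bool" where
  "stays_nonneg v \<longleftrightarrow> (\<forall>k\<le>length v. 0 \<le> sum_list (take k v))"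

lemma sum_list_drop_eq: "sum_list (drop k v) = sum_list v - sum_list (take k v)"
  for v :: "int list"
  by (metis add_diff_cancel_left' append_take_drop_id sum_list_append)

lemma sum_list_Min_le_Max:
  assumes "Dyck_N_walk w"
  shows "sum_list (map Min w) \<le> sum_list (map Max w)"
  by (rule sum_list_mono) (use assms in \<open>auto simp: Dyck_N_walk_def Dyck_N_steps_def\<close>)

text \<open>Reversal and negation turn the suffix condition on the lower reading into a prefix
  condition, so that both conditions become events of the same kind.\<close>

lemma sum_list_take_neg_Min:
  fixes w :: "int set list"
  assumes "k \<le> length w"
  shows "sum_list (take k (map (\<lambda>s. - Min s) (rev w))) = - sum_list (drop (length w - k) (map Min w))"
proof -
  have "sum_list (take k (map (\<lambda>s. - Min s) (rev w))) =
      sum_list (map (\<lambda>s. - Min s) (drop (length w - k) w))"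
    using assms by (simp add: take_map take_rev drop_map flip: rev_map)
  also have "\<dots> = - sum_list (drop (length w - k) (map Min w))"
    by (simp add: drop_map uminus_sum_list_map o_def)
  finally show ?thesis .
qed

lemma even_height_parity:
  assumes "Dyck_N_walk w"
  shows "even (sum_list (map Min w)) \<longleftrightarrow> even (length w)"
  using assms by (induction w) (auto simp: Dyck_N_walk_def Dyck_N_steps_def)

lemma compatible_bounds:
  assumes "compatible v w" "Dyck_N_walk w"
  shows "sum_list v \<le> sum_list (map Max w)" "sum_list (map Min w) \<le> sum_list v"
  using assms
  unfolding compatible_def
  by (induction v w rule: list_all2_induct) (auto simp: Dyck_N_walk_def Dyck_N_steps_def)

lemma Dyck_N_walk_take_drop:
  assumes "Dyck_N_walk w"
  shows "Dyck_N_walk (take k w)" "Dyck_N_walk (drop k w)"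
  using assms set_take_subset[of k w] set_drop_subset[of k w] by (auto simp: Dyck_N_walk_def)

text \<open>On \<open>{-1, 1}\<close> the walk goes down whenever the prefix condition survives this; otherwise it
  goes up, and parity restores the condition on the final height.\<close>

lemma exists_compatible_from_height:
  assumes "Dyck_N_walk w"
    and "even (h + int (length w))"
    and "\<And>k. k \<le> length w \<Longrightarrow> 0 \<le> h + sum_list (take k (map Max w))"
    and "\<And>k. 1 \<le> k \<Longrightarrow> k \<le> length w \<Longrightarrow> sum_list (drop k (map Min w)) \<le> 0"
    and "h + sum_list (map Min w) \<le> 0"
  shows "\<exists>v. compatible v w \<and> (\<forall>k\<le>length v. 0 \<le> h + sum_list (take k v)) \<and> h + sum_list v = 0"
  using assms
proof (induction w arbitrary: h)
  case Nil
  then show ?case by (auto simp: compatible_def)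
next
  case (Cons s w)
  have w: "Dyck_N_walk w" and s: "s = {-1} \<or> s = {1} \<or> s = {-1, 1}"
    using Cons.prems(1) by (auto simp: Dyck_N_walk_def Dyck_N_steps_def)
  have h: "0 \<le> h" using Cons.prems(3)[of 0] by simp
  have up: "0 \<le> h + Max s + sum_list (take k (map Max w))" if "k \<le> length w" for k
    using Cons.prems(3)[of "Suc k"] that by (simp add: algebra_simps)
  have low: "sum_list (drop k (map Min w)) \<le> 0" if "k \<le> length w" for k
    using Cons.prems(4)[of "Suc k"] that by simp
  have step: ?case if x: "x \<in> s" and odd: "odd x"
    and 1: "\<And>k. k \<le> length w \<Longrightarrow> 0 \<le> h + x + sum_list (take k (map Max w))"
    and 2: "h + x + sum_list (map Min w) \<le> 0" for x
  proof -
    have "even (h + x + int (length w))" using Cons.prems(2) odd by simp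
    from Cons.IH[OF w this 1 low 2] obtain v where
      v: "compatible v w" "\<And>k. k \<le> length v \<Longrightarrow> 0 \<le> h + x + sum_list (take k v)"
         "h + x + sum_list v = 0" by auto
    have "0 \<le> h + sum_list (take k (x # v))" if "k \<le> length (x # v)" for k
      using v(2)[of "k - 1"] h that by (cases k) (auto simp: add.assoc)
    then show ?thesis using v x by (intro exI[of _ "x # v"]) (auto simp: compatible_def add.assoc)
  qed
  consider "s = {-1}" | "s = {1}" | "s = {-1, 1}" using s by blast
  then show ?case
  proof cases
    case 1
    then show ?thesis using step[of "-1"] up Cons.prems(5) by (simp add: add.assoc)
  next
    case 2
    then show ?thesis using step[of 1] up Cons.prems(5) by (simp add: add.assoc)
  next
    case 3
    show ?thesis
    proof (cases "\<forall>k\<le>length w. 0 \<le> h + - 1 + sum_list (take k (map Max w))")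
      case True
      then show ?thesis using step[of "-1"] 3 Cons.prems(5) by (simp add: add.assoc)
    next
      case False
      \<comment> \<open>At such a \<open>k\<close> even the upper reading, started at
        \<open>h\<close>, is at most 0. The lower reading is below it, and the suffix after
        \<open>k\<close> adds at most 0. The final lower height is therefore at most 0, and being
        odd at most -1, which leaves room for an up-step.\<close>
      then obtain k where k: "k \<le> length w" "h + sum_list (take k (map Max w)) \<le> 0" by force
      have "sum_list (take k (map Min w)) \<le> sum_list (take k (map Max w))"
        using sum_list_Min_le_Max[OF Dyck_N_walk_take_drop(1)[OF w]] by (simp add: take_map)
      then have "h + sum_list (map Min w) \<le> 0"
        using low[OF k(1)] k(2) by (simp add: sum_list_drop_eq)
      moreover have "odd (h + sum_list (map Min w))"
        using even_height_parity[OF w] Cons.prems(2) by simp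
      ultimately have "h + 1 + sum_list (map Min w) \<le> 0"
        by (cases "h + sum_list (map Min w) = 0") auto
      then show ?thesis using step[of 1] 3 up by simp
    qed
  qed
qed

text \<open>Necessity: an excursion lies below the upper reading on every prefix, and its suffix
  sums, being the negatives of its prefix sums, lie above those of the lower reading. Sufficiency:
  the greedy walk started at height 0.\<close>

lemma Dyck_N_excursion_iff:
  assumes "Dyck_N_walk w" "even (length w)"
  shows "Dyck_N_excursion w \<longleftrightarrow>
    stays_nonneg (map Max w) \<and> stays_nonneg (map (\<lambda>s. - Min s) (rev w))"
proof -
  have suffix: "stays_nonneg (map (\<lambda>s. - Min s) (rev w)) \<longleftrightarrow>
      (\<forall>k\<le>length w. sum_list (drop k (map Min w)) \<le> 0)" (is "?L = ?R")
  proof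
    assume ?L
    show ?R
    proof safe
      fix k assume k: "k \<le> length w"
      have "0 \<le> sum_list (take (length w - k) (map (\<lambda>s. - Min s) (rev w)))"
        using \<open>?L\<close> by (simp add: stays_nonneg_def)
      with sum_list_take_neg_Min[of "length w - k" w] k show "sum_list (drop k (map Min w)) \<le> 0" by simp
    qed
  qed (auto simp: stays_nonneg_def sum_list_take_neg_Min)
  show ?thesis
  proof
    assume "Dyck_N_excursion w"
    then obtain v where v: "compatible v w" "excursion v" by (auto simp: Dyck_N_excursion_def)
    have len: "length v = length w" using v(1) by (auto simp: compatible_def list_all2_lengthD)
    have *: "0 \<le> sum_list (take k (map Max w)) \<and> sum_list (drop k (map Min w)) \<le> 0"
      if "k \<le> length w" for k
    proof -
      have "0 \<le> sum_list (take k v)" "sum_list v = 0"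
        using v(2) that len by (auto simp: excursion_def)
      moreover have "compatible (take k v) (take k w)" "compatible (drop k v) (drop k w)"
        using v(1) by (auto simp: compatible_def list_all2_takeI list_all2_dropI)
      note compatible_bounds(1)[OF this(1)] compatible_bounds(2)[OF this(2)]
      ultimately show ?thesis
        using Dyck_N_walk_take_drop[OF assms(1)]
        by (smt (verit) drop_map sum_list_drop_eq take_map)
    qed
    then show "stays_nonneg (map Max w) \<and> stays_nonneg (map (\<lambda>s. - Min s) (rev w))"
      unfolding suffix by (simp add: stays_nonneg_def)
  next
    assume "stays_nonneg (map Max w) \<and> stays_nonneg (map (\<lambda>s. - Min s) (rev w))"
    then have "\<And>k. k \<le> length w \<Longrightarrow> 0 \<le> sum_list (take k (map Max w))"
      and "\<And>k. k \<le> length w \<Longrightarrow> sum_list (drop k (map Min w)) \<le> 0"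
      unfolding suffix by (simp_all add: stays_nonneg_def)
    from exists_compatible_from_height[OF assms(1), of 0] this this(2)[of 0] assms(2)
    show "Dyck_N_excursion w"
      using assms(1) by (auto simp: Dyck_N_excursion_def excursion_def)
  qed
qed

section \<open>First passages\<close>

text \<open>The list must end at the very step that makes the height negative. Recursion on the
  starting height is what becomes the one-step recursion for the probabilities.\<close>

fun first_passage :: "int \<Rightarrow> int list \<Rightarrow> bool" where
  "first_passage h [] \<longleftrightarrow> h < 0"
| "first_passage h (x # v) \<longleftrightarrow> 0 \<le> h \<and> first_passage (h + x) v"

lemma first_passage_iff:
  "first_passage h v \<longleftrightarrow> h + sum_list v < 0 \<and> (\<forall>k<length v. 0 \<le> h + sum_list (take k v))"
proof (induction v arbitrary: h)
  case (Cons x v)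
  show ?case
    unfolding first_passage.simps Cons.IH by (force simp: All_less_Suc2 add.assoc)
qed simp

lemma first_passage_unique:
  assumes "first_passage h (take i v)" "first_passage h (take j v)" "i \<le> length v" "j \<le> length v"
  shows "i = j"
proof -
  have False if "first_passage h (take i v)" "first_passage h (take j v)" "i < j" "j \<le> length v" for i j
    using that by (auto simp: first_passage_iff dest!: spec[of _ i])
  then show ?thesis using assms by (metis linorder_neqE_nat)
qed

lemma not_stays_nonneg_iff:
  "\<not> stays_nonneg v \<longleftrightarrow> (\<exists>k\<le>length v. first_passage 0 (take k v))"
proof
  assume "\<not> stays_nonneg v"
  then obtain k where "k \<le> length v \<and> sum_list (take k v) < 0"
    by (auto simp: stays_nonneg_def not_le)
  then obtain m where m: "m \<le> length v \<and> sum_list (take m v) < 0"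
    and min: "\<And>j. j < m \<Longrightarrow> \<not> (j \<le> length v \<and> sum_list (take j v) < 0)"
    using exists_least_iff[of "\<lambda>k. k \<le> length v \<and> sum_list (take k v) < 0"] by blast
  have "first_passage 0 (take m v)"
    using m min by (force simp: first_passage_iff min_def not_less)
  with m show "\<exists>k\<le>length v. first_passage 0 (take k v)" by blast
qed (force simp: stays_nonneg_def first_passage_iff not_le)

section \<open>Words with independent letters: images, reversal, independence of disjoint
  blocks\<close>

lemma map_replicate_pmf: "map_pmf (map f) (replicate_pmf n p) = replicate_pmf n (map_pmf f p)"
proof (induction n)
  case (Suc n)
  then show ?case
    by (simp add: map_bind_pmf bind_map_pmf map_pmf_comp flip: Suc map_pmf_def)
qed simp

lemma replicate_pmf_add:
  "replicate_pmf (m + n) p =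
    map_pmf (\<lambda>(xs, ys). xs @ ys) (pair_pmf (replicate_pmf m p) (replicate_pmf n p))"
  by (simp add: replicate_pmf_distrib pair_pmf_def map_pmf_def bind_assoc_pmf bind_return_pmf)

lemma rev_replicate_pmf: "map_pmf rev (replicate_pmf n p) = replicate_pmf n p"
proof (induction n)
  case (Suc n)
  have "map_pmf rev (replicate_pmf (Suc n) p) =
      p \<bind> (\<lambda>x. map_pmf (\<lambda>xs. xs @ [x]) (map_pmf rev (replicate_pmf n p)))"
    by (simp add: map_bind_pmf map_pmf_comp map_pmf_def bind_assoc_pmf bind_return_pmf)
  also have "\<dots> = replicate_pmf n p \<bind> (\<lambda>xs. p \<bind> (\<lambda>x. return_pmf (xs @ [x])))"
    unfolding Suc by (subst bind_commute_pmf) (simp add: map_pmf_def bind_return_pmf)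
  also have "\<dots> = replicate_pmf (n + 1) p"
    unfolding replicate_pmf_distrib replicate_pmf_1
    by (simp add: map_pmf_def bind_assoc_pmf bind_return_pmf)
  finally show ?case by simp
qed simp

lemma prob_pair_pmf:
  "measure_pmf.prob (pair_pmf p q) ({x. P x} \<times> {y. Q y}) =
    measure_pmf.prob p {x. P x} * measure_pmf.prob q {y. Q y}"
proof -
  \<comment> \<open>The product rule applied below asks for countable sets, so each event is first
    cut down to the support of its law.\<close>
  have "measure_pmf.prob (pair_pmf p q) ({x. P x} \<times> {y. Q y}) =
      measure_pmf.prob (pair_pmf p q) (({x. P x} \<inter> set_pmf p) \<times> ({y. Q y} \<inter> set_pmf q))"
    by (rule measure_prob_cong_0) (auto simp: pmf_pair pmf_eq_0_set_pmf)
  also have "\<dots> = measure_pmf.prob p ({x. P x} \<inter> set_pmf p) * measure_pmf.prob q ({y. Q y} \<inter> set_pmf q)"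
    by (intro measure_pmf_prob_product countable_Int2 countable_set_pmf)
  finally show ?thesis by (simp add: measure_Int_set_pmf)
qed

lemma prob_replicate_pmf_add:
  "measure_pmf.prob (replicate_pmf (m + n) p) {w. P (take m w) \<and> Q (drop m w)} =
    measure_pmf.prob (replicate_pmf m p) {w. P w} * measure_pmf.prob (replicate_pmf n p) {w. Q w}"
proof -
  have "measure_pmf.prob (replicate_pmf (m + n) p) {w. P (take m w) \<and> Q (drop m w)} =
    measure_pmf.prob (pair_pmf (replicate_pmf m p) (replicate_pmf n p))
      {z. P (take m (fst z @ snd z)) \<and> Q (drop m (fst z @ snd z))}"
    unfolding replicate_pmf_add measure_map_pmf by (simp add: vimage_def case_prod_beta)
  also have "\<dots> = measure_pmf.prob (pair_pmf (replicate_pmf m p) (replicate_pmf n p))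
      ({x. P x} \<times> {y. Q y})"
    by (rule measure_prob_cong_0) (force simp: pmf_eq_0_set_pmf set_replicate_pmf)+
  finally show ?thesis by (simp add: prob_pair_pmf)
qed

lemma prob_replicate_pmf_take:
  assumes "k \<le> n"
  shows "measure_pmf.prob (replicate_pmf n p) {w. P (take k w)} =
    measure_pmf.prob (replicate_pmf k p) {w. P w}"
  using prob_replicate_pmf_add[of k "n - k" p P "\<lambda>_. True"] assms by simp

lemma prob_replicate_pmf_rev:
  "measure_pmf.prob (replicate_pmf n p) {w. P (rev w)} =
    measure_pmf.prob (replicate_pmf n p) {w. P w}"
proof -
  have "measure_pmf.prob (map_pmf rev (replicate_pmf n p)) {w. P w} =
    measure_pmf.prob (replicate_pmf n p) {w. P (rev w)}"
    by (simp add: vimage_def)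
  then show ?thesis by (simp add: rev_replicate_pmf)
qed

lemma prob_replicate_pmf_take_rev:
  assumes "k \<le> n"
  shows "measure_pmf.prob (replicate_pmf n p) {w. P (take k (rev w))} =
    measure_pmf.prob (replicate_pmf k p) {w. P w}"
  using prob_replicate_pmf_rev[of n p "\<lambda>w. P (take k w)"] prob_replicate_pmf_take[OF assms, of p P]
  by simp

text \<open>As \<open>k + l \<le> n\<close>, the last \<open>l\<close> letters avoid the first
  \<open>k\<close>, so the two events live on independent blocks; reading the second block backwards
  does not change its law.\<close>

lemma prob_replicate_pmf_both_ends:
  assumes "k + l \<le> n"
  shows "measure_pmf.prob (replicate_pmf n p) {w. P (take k w) \<and> Q (take l (rev w))} =
    measure_pmf.prob (replicate_pmf k p) {w. P w} * measure_pmf.prob (replicate_pmf l p) {w. Q w}"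
proof -
  have eq: "take l (rev w) = take l (rev (drop k w))" if "length w = n" for w :: "'a list"
    using that assms by (simp add: take_rev)
  have "measure_pmf.prob (replicate_pmf n p) {w. P (take k w) \<and> Q (take l (rev w))} =
      measure_pmf.prob (replicate_pmf n p) {w. P (take k w) \<and> Q (take l (rev (drop k w)))}"
    by (rule measure_prob_cong_0) (auto simp: pmf_eq_0_set_pmf set_replicate_pmf eq[symmetric])
  also have "\<dots> = measure_pmf.prob (replicate_pmf (k + (n - k)) p)
      {w. P (take k w) \<and> Q (take l (rev (drop k w)))}"
    using assms by simp
  also have "\<dots> = measure_pmf.prob (replicate_pmf k p) {w. P w} *
      measure_pmf.prob (replicate_pmf (n - k) p) {w. Q (take l (rev w))}"
    by (rule prob_replicate_pmf_add)
  also have "measure_pmf.prob (replicate_pmf (n - k) p) {w. Q (take l (rev w))} =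
      measure_pmf.prob (replicate_pmf l p) {w. Q w}"
    by (rule prob_replicate_pmf_take_rev) (use assms in simp)
  finally show ?thesis .
qed

text \<open>Here \<open>q\<close> is the probability of a down-step. Only the start
  \<open>h = 0\<close> is needed in the end; general \<open>h\<close> makes the recursion
  possible.\<close>

definition passage_prob :: "real \<Rightarrow> int \<Rightarrow> nat \<Rightarrow> real" where
  "passage_prob q h n = measure_pmf.prob
     (replicate_pmf n (map_pmf (\<lambda>b. if b then -1 else 1) (bernoulli_pmf q))) {v. first_passage h v}"

lemma passage_prob_0: "passage_prob q h 0 = (if h < 0 then 1 else 0)"
  by (simp add: passage_prob_def)

lemma passage_prob_Suc:
  assumes "0 \<le> q" "q \<le> 1"
  shows "passage_prob q h (Suc n) =
    (if h < 0 then 0 else q * passage_prob q (h - 1) n + (1 - q) * passage_prob q (h + 1) n)"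
proof -
  let ?d = "map_pmf (\<lambda>b. if b then -1 else 1 :: int) (bernoulli_pmf q)"
  have "passage_prob q h (Suc n) =
      (\<integral>b. measure_pmf.prob (map_pmf ((#) (if b then -1 else 1)) (replicate_pmf n ?d))
        {v. first_passage h v} \<partial>bernoulli_pmf q)"
    unfolding passage_prob_def
    by (simp add: bind_map_pmf measure_pmf_bind measure_pmf.measure_bind[where N = "count_space UNIV"]
        measure_pmf_in_subprob_space flip: map_pmf_def del: measure_map_pmf)
  also have "\<dots> = q * measure_pmf.prob (map_pmf ((#) (- 1)) (replicate_pmf n ?d)) {v. first_passage h v}
     + (1 - q) * measure_pmf.prob (map_pmf ((#) 1) (replicate_pmf n ?d)) {v. first_passage h v}"
    using assms by simp
  finally show ?thesis by (simp add: passage_prob_def vimage_def)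
qed

section \<open>Catalan weights\<close>

text \<open>The Catalan number over \<open>4 ^ n\<close>, which moves the radius of convergence to
  1.\<close>

definition catalan_weight :: "nat \<Rightarrow> real" where
  "catalan_weight n = real ((2 * n) choose n) / (4 ^ n * real (n + 1))"

text \<open>The probability that the symmetric simple walk is back at 0 at time
  \<open>2 * n\<close>.\<close>

definition central_binomial_weight :: "nat \<Rightarrow> real" where
  "central_binomial_weight n = real ((2 * n) choose n) / 4 ^ n"

lemma central_binomial_weight_0 [simp]: "central_binomial_weight 0 = 1"
  by (simp add: central_binomial_weight_def)

lemma central_binomial_weight_pos: "0 < central_binomial_weight n"
  by (simp add: central_binomial_weight_def)

lemma central_binomial_weight_Suc:
  "central_binomial_weight (Suc n) = central_binomial_weight n * (2 * n + 1) / (2 * n + 2)"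
proof -
  define x where "x = (2 * n) choose n"
  define y where "y = Suc (2 * n) choose n"
  define z where "z = (2 * Suc n) choose Suc n"
  have "Suc n * z = Suc n * (2 * y)"
    using Suc_times_binomial[of n "Suc (2 * n)"] by (simp add: y_def z_def)
  then have z: "z = 2 * y"
    by (simp only: mult_cancel1) simp
  have "Suc n * y = Suc (2 * n) * x"
    using binomial_absorb_comp[of "Suc (2 * n)" n] by (simp add: x_def y_def)
  then have "real (Suc n) * real y = real (Suc (2 * n)) * real x"
    by (simp only: flip: of_nat_mult)
  then have "real z = real x * 4 * (2 * n + 1) / (2 * n + 2)"
    by (simp add: z field_simps)
  then show ?thesis
    unfolding central_binomial_weight_def z_def[symmetric] x_def[symmetric] by simp
qed

lemma catalan_weight_eq: "catalan_weight n = central_binomial_weight n / (n + 1)"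
  by (simp add: catalan_weight_def central_binomial_weight_def)

lemma catalan_weight_0 [simp]: "catalan_weight 0 = 1"
  by (simp add: catalan_weight_def)

lemma catalan_weight_pos: "0 < catalan_weight n"
  by (simp add: catalan_weight_def)

lemma catalan_weight_Suc: "catalan_weight (Suc n) = catalan_weight n * (2 * n + 1) / (2 * n + 4)"
  by (simp add: catalan_weight_eq central_binomial_weight_Suc field_simps)

text \<open>Makes the sums over the critical series, where \<open>4 * q * (1 - q) = 1\<close>,
  exactly computable.\<close>

lemma catalan_weight_telescope:
  "catalan_weight n = 2 * (central_binomial_weight n - central_binomial_weight (Suc n))"
  by (simp add: catalan_weight_eq central_binomial_weight_Suc field_simps)

text \<open>With \<open>m\<close> up-steps, a first passage from height \<open>h\<close> to \<open>-1\<close> has length \<open>2 * m + h + 1\<close>; the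
  factor multiplying the weight is the ballot number.\<close>

fun ballot :: "nat \<Rightarrow> nat \<Rightarrow> nat" where
  "ballot 0 m = (if m = 0 then 1 else 0)"
| "ballot (Suc d) 0 = 1"
| "ballot (Suc d) (Suc m) = ballot d (Suc m) + ballot (Suc (Suc d)) m"

lemma ballot_right_0 [simp]: "ballot d 0 = 1"
  by (cases d) auto

text \<open>The ballot theorem, multiplied out so that \<open>d = m = 0\<close> is covered. In the
  inductive step all binomials are expressed through one, \<open>x\<close>, and a rational identity
  remains.\<close>

lemma ballot_closed_form: "(2 * m + d) * ballot d m = d * ((2 * m + d) choose m)"
proof (induction d m rule: ballot.induct)
  case (3 d m)
  define N where "N = 2 * m + d + 2"
  define x where "x = real (N choose m)"
  have "Suc m * (N choose Suc m) = (m + d + 2) * (N choose m)"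
    using binomial_absorption[of m N] binomial_absorb_comp[of N m] by (simp add: N_def)
  then have "real (Suc m) * real (N choose Suc m) = (m + d + 2) * x"
    unfolding x_def by (metis of_nat_mult)
  then have 1: "real (N choose Suc m) = (m + d + 2) * x / (m + 1)"
    by (simp add: field_simps)
  have "Suc m * (Suc N choose Suc m) = Suc N * (N choose m)"
    by (rule Suc_times_binomial)
  then have "real (Suc m) * real (Suc N choose Suc m) = (N + 1) * x"
    unfolding x_def by (metis of_nat_mult Suc_eq_plus1)
  then have 2: "real (Suc N choose Suc m) = (N + 1) * x / (m + 1)"
    by (simp add: field_simps del: binomial_Suc_Suc)
  have "N * ballot d (Suc m) = d * (N choose Suc m)"
    using "3.IH"(1) by (simp add: N_def)
  then have 3: "real (ballot d (Suc m)) = d * real (N choose Suc m) / N"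
    unfolding N_def by (simp add: field_simps flip: of_nat_mult)
  have "N * ballot (Suc (Suc d)) m = (d + 2) * (N choose m)"
    using "3.IH"(2) by (simp add: N_def)
  then have 4: "real (ballot (Suc (Suc d)) m) = (d + 2) * x / N"
    unfolding N_def x_def by (simp add: field_simps flip: of_nat_mult)
  have "real ((Suc N) * ballot (Suc d) (Suc m)) = real (Suc d * (Suc N choose Suc m))"
    unfolding ballot.simps of_nat_mult of_nat_add 3 4 1 2
    by (simp add: N_def divide_simps) (simp add: algebra_simps)
  then show ?case by (simp add: N_def del: of_nat_mult binomial_Suc_Suc ballot.simps)
qed simp_all

lemma ballot_1: "real (ballot 1 m) = 4 ^ m * catalan_weight m"
proof -
  have "(2 * m + 1) * ballot 1 m = Suc (2 * m) choose m"
    using ballot_closed_form[of m 1] by simp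
  moreover have "Suc m * (Suc (2 * m) choose m) = Suc (2 * m) * ((2 * m) choose m)"
    using binomial_absorb_comp[of "Suc (2 * m)" m] by simp
  ultimately have "(2 * m + 1) * (Suc m * ballot 1 m) = (2 * m + 1) * ((2 * m) choose m)"
    by (metis Suc_eq_plus1 mult.left_commute)
  then have "real (Suc m * ballot 1 m) = real ((2 * m) choose m)"
    by (simp only: mult_cancel1) simp
  then have "real (Suc m) * real (ballot 1 m) = real ((2 * m) choose m)"
    by (simp only: of_nat_mult)
  then show ?thesis
    unfolding catalan_weight_def by (simp add: divide_simps mult_ac del: ballot.simps)
qed

lemma passage_prob_too_high:
  assumes "0 \<le> q" "q \<le> 1" "int n \<le> h"
  shows "passage_prob q h n = 0"
  using assms(3) by (induction n arbitrary: h) (auto simp: passage_prob_0 passage_prob_Suc assms)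

text \<open>The bound \<open>- 1 \<le> h\<close> is the invariant of the induction: a down-step is
  taken only from a nonnegative height. Below -1 the claim fails, as the empty list is a passage
  from -2.\<close>

lemma passage_prob_parity:
  assumes "0 \<le> q" "q \<le> 1" "- 1 \<le> h" "even (h + int n)"
  shows "passage_prob q h n = 0"
  using assms(3,4)
  by (induction n arbitrary: h) (auto simp: passage_prob_0 passage_prob_Suc assms)

text \<open>With \<open>d\<close> the distance from the start to -1, \<open>m\<close> up-steps force
  \<open>m + d\<close> down-steps. The recursion of \<open>ballot\<close> is the choice of the first
  step: down lowers \<open>d\<close>, up raises \<open>d\<close> and uses up one of the
  \<open>m\<close>.\<close>

lemma passage_prob_ballot:
  assumes q: "0 \<le> q" "q \<le> 1"
  shows "passage_prob q (int d - 1) (2 * m + d) = real (ballot d m) * q ^ (m + d) * (1 - q) ^ m"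
proof (induction d m rule: ballot.induct)
  case (1 m)
  then show ?case using q by (cases m) (auto simp: passage_prob_0 passage_prob_Suc)
next
  case (2 d)
  have "passage_prob q (int d - 1) d = q ^ d"
  proof (induction d)
    case (Suc d)
    then show ?case using q by (simp add: passage_prob_Suc passage_prob_too_high)
  qed (simp add: passage_prob_0)
  with q show ?case by (simp add: passage_prob_Suc passage_prob_too_high)
next
  case (3 d m)
  have up: "passage_prob q (int (Suc d) - 1 + 1) (2 * Suc m + d) =
      real (ballot (Suc (Suc d)) m) * q ^ (m + d + 2) * (1 - q) ^ m"
    using "3.IH"(2) by (simp add: add.commute)
  have down: "passage_prob q (int (Suc d) - 1 - 1) (2 * Suc m + d) =
      real (ballot d (Suc m)) * q ^ (Suc m + d) * (1 - q) ^ Suc m"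
    using "3.IH"(1) by simp
  have "passage_prob q (int (Suc d) - 1) (Suc (2 * Suc m + d)) =
      q * (real (ballot d (Suc m)) * q ^ (Suc m + d) * (1 - q) ^ Suc m) +
      (1 - q) * (real (ballot (Suc (Suc d)) m) * q ^ (m + d + 2) * (1 - q) ^ m)"
    unfolding passage_prob_Suc[OF q] up down by simp
  then show ?case by (simp add: algebra_simps)
qed

lemma passage_prob_catalan:
  assumes "0 \<le> q" "q \<le> 1"
  shows "passage_prob q 0 (2 * m + 1) = q * catalan_weight m * (4 * q * (1 - q)) ^ m"
  using passage_prob_ballot[OF assms, of 1 m] ballot_1[of m]
  by (simp add: power_mult_distrib)

section \<open>Inclusion--exclusion\<close>

text \<open>On an overlap the upper reading would have negative sum, since the bad prefix is the
  shortest one, and the lower reading positive sum, since the bad suffix is the shortest one. But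
  the lower reading never exceeds the upper.\<close>

lemma first_passages_no_overlap:
  assumes w: "Dyck_N_walk w" and "k \<le> length w" "l \<le> length w"
    and up: "first_passage 0 (take k (map Max w))"
    and down: "first_passage 0 (take l (map (\<lambda>s. - Min s) (rev w)))"
  shows "k + l \<le> length w"
proof (rule ccontr)
  assume "\<not> k + l \<le> length w"
  define k' where "k' = length w - l"
  have k': "k' < k" "length w - k < l"
    using \<open>\<not> k + l \<le> length w\<close> assms(2,3) by (auto simp: k'_def)
  have "sum_list (take k (map Max w)) < 0"
    using up by (simp add: first_passage_iff)
  moreover have "0 \<le> sum_list (take k' (map Max w))"
    using up k' assms(2) by (auto simp: first_passage_iff min.absorb2 dest!: spec[of _ k'])
  moreover have "0 < sum_list (drop k' (map Min w))"
    using down sum_list_take_neg_Min[of l w] assms(3) by (simp add: first_passage_iff k'_def)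
  moreover have "sum_list (drop k (map Min w)) \<le> 0"
    using down sum_list_take_neg_Min[of "length w - k" w] k' assms(2,3)
    by (auto simp: first_passage_iff min.absorb2 dest!: spec[of _ "length w - k"])
  moreover have "sum_list (map Min (take (k - k') (drop k' w))) \<le> sum_list (map Max (take (k - k') (drop k' w)))"
    by (intro sum_list_Min_le_Max Dyck_N_walk_take_drop w)
  moreover have middle: "sum_list (map f (take (k - k') (drop k' w))) =
      sum_list (take k (map f w)) - sum_list (take k' (map f w))" for f :: "int set \<Rightarrow> int"
  proof -
    have "take k w = take k' w @ take (k - k') (drop k' w)"
      using k' by (metis less_imp_le le_add_diff_inverse take_add)
    then show ?thesis by (simp add: take_map)
  qed
  ultimately show False
    by (simp add: sum_list_drop_eq)
qed

section \<open>The laws of the two readings, and odd passage times\<close>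

lemma pmf_eq_map_bernoulli:
  assumes "set_pmf d \<subseteq> {-1, 1 :: int}"
  shows "d = map_pmf (\<lambda>b. if b then -1 else 1) (bernoulli_pmf (pmf d (- 1)))"
proof (rule pmf_eqI)
  fix i :: int
  have "pmf d (- 1) + pmf d 1 = 1"
    using sum_pmf_eq_1[of "{-1, 1}" d] assms by simp
  moreover have "(\<lambda>b. if b then -1 else 1 :: int) -` {i} =
      (if i = -1 then {True} else if i = 1 then {False} else {})"
    by (auto split: if_splits)
  moreover have "i \<noteq> -1 \<Longrightarrow> i \<noteq> 1 \<Longrightarrow> pmf d i = 0"
    using assms by (auto simp: pmf_eq_0_set_pmf)
  ultimately show "pmf d i = pmf (map_pmf (\<lambda>b. if b then -1 else 1) (bernoulli_pmf (pmf d (- 1)))) i"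
    by (auto simp: pmf_map measure_pmf_single pmf_le_1)
qed

text \<open>Only \<open>{-1}\<close> has maximum -1, so \<open>{-1, 1}\<close> counts as an up-step.
  It does so in the negated lower reading as well, where only \<open>{1}\<close> goes down.\<close>

lemma map_Max_Dyck_N_step_pmf:
  assumes "set_pmf p \<subseteq> Dyck_N_steps"
  shows "map_pmf Max p = map_pmf (\<lambda>b. if b then -1 else 1) (bernoulli_pmf (pmf p {-1}))"
proof -
  have "pmf (map_pmf Max p) (- 1) = measure_pmf.prob p {{-1}}"
    unfolding pmf_map
    by (rule measure_prob_cong_0) (use assms in \<open>auto simp: Dyck_N_steps_def pmf_eq_0_set_pmf\<close>)
  moreover have "set_pmf (map_pmf Max p) \<subseteq> {-1, 1}"
    using assms by (auto simp: Dyck_N_steps_def)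
  ultimately show ?thesis
    using pmf_eq_map_bernoulli[of "map_pmf Max p"] by (simp add: measure_pmf_single)
qed

lemma map_neg_Min_Dyck_N_step_pmf:
  assumes "set_pmf p \<subseteq> Dyck_N_steps"
  shows "map_pmf (\<lambda>s. - Min s) p = map_pmf (\<lambda>b. if b then -1 else 1) (bernoulli_pmf (pmf p {1}))"
proof -
  have "pmf (map_pmf (\<lambda>s. - Min s) p) (- 1) = measure_pmf.prob p {{1}}"
    unfolding pmf_map
    by (rule measure_prob_cong_0) (use assms in \<open>auto simp: Dyck_N_steps_def pmf_eq_0_set_pmf\<close>)
  moreover have "set_pmf (map_pmf (\<lambda>s. - Min s) p) \<subseteq> {-1, 1}"
    using assms by (auto simp: Dyck_N_steps_def)
  ultimately show ?thesis
    using pmf_eq_map_bernoulli[of "map_pmf (\<lambda>s. - Min s) p"] by (simp add: measure_pmf_single)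
qed

lemma prob_map_first_passage:
  assumes "map_pmf f p = map_pmf (\<lambda>b. if b then -1 else 1) (bernoulli_pmf q)"
  shows "measure_pmf.prob (replicate_pmf n p) {w. first_passage h (map f w)} = passage_prob q h n"
proof -
  have "passage_prob q h n = measure_pmf.prob (map_pmf (map f) (replicate_pmf n p)) {v. first_passage h v}"
    by (simp add: passage_prob_def map_replicate_pmf assms)
  then show ?thesis by (simp add: vimage_def)
qed

lemma sum_odd_indices:
  fixes f :: "nat \<Rightarrow> real"
  assumes "\<And>k. even k \<Longrightarrow> f k = 0"
  shows "(\<Sum>k\<le>2 * n. f k) = (\<Sum>i<n. f (2 * i + 1))"
  using assms by (induction n) simp_all

lemma double_sum_odd_indices:
  fixes f g :: "nat \<Rightarrow> real"
  assumes f: "\<And>k. even k \<Longrightarrow> f k = 0" and g: "\<And>k. even k \<Longrightarrow> g k = 0"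
  shows "(\<Sum>k\<le>2 * n. \<Sum>l\<le>2 * n. if k + l \<le> 2 * n then f k * g l else 0) =
    (\<Sum>j<n. g (2 * j + 1) * (\<Sum>i<n - j. f (2 * i + 1)))"
proof -
  have inner: "(\<Sum>k\<le>2 * n. if k + (2 * j + 1) \<le> 2 * n then f k * g (2 * j + 1) else 0) =
      g (2 * j + 1) * (\<Sum>i<n - j. f (2 * i + 1))" if "j < n" for j
  proof -
    have "(\<Sum>k\<le>2 * n. if k + (2 * j + 1) \<le> 2 * n then f k * g (2 * j + 1) else 0) =
        (\<Sum>k\<le>2 * (n - j). f k * g (2 * j + 1))"
    proof (rule sum.mono_neutral_cong_right)
      show "\<And>k. k \<in> {..2 * (n - j)} \<Longrightarrow>
          (if k + (2 * j + 1) \<le> 2 * n then f k * g (2 * j + 1) else 0) = f k * g (2 * j + 1)"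
      proof -
        fix k assume "k \<in> {..2 * (n - j)}"
        then have "k + (2 * j + 1) \<le> 2 * n \<or> k = 2 * (n - j)" using that by auto
        then show "(if k + (2 * j + 1) \<le> 2 * n then f k * g (2 * j + 1) else 0) = f k * g (2 * j + 1)"
          using f[of "2 * (n - j)"] by auto
      qed
    qed auto
    also have "\<dots> = g (2 * j + 1) * (\<Sum>k\<le>2 * (n - j). f k)"
      by (simp add: sum_distrib_left mult.commute)
    finally show ?thesis by (simp only: sum_odd_indices[of f, OF f])
  qed
  have "(\<Sum>k\<le>2 * n. \<Sum>l\<le>2 * n. if k + l \<le> 2 * n then f k * g l else 0) =
      (\<Sum>l\<le>2 * n. \<Sum>k\<le>2 * n. if k + l \<le> 2 * n then f k * g l else 0)"
    by (rule sum.swap)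
  also have "\<dots> = (\<Sum>j<n. \<Sum>k\<le>2 * n. if k + (2 * j + 1) \<le> 2 * n then f k * g (2 * j + 1) else 0)"
    by (rule sum_odd_indices) (auto simp: g intro!: sum.neutral)
  finally show ?thesis using inner by simp
qed

text \<open>Inclusion--exclusion over a shortest bad prefix and a shortest bad suffix, which are disjoint
  and hence independent.\<close>

lemma prob_Dyck_N_excursion_passage:
  fixes p :: "int set pmf"
  assumes p: "set_pmf p \<subseteq> Dyck_N_steps"
  defines "f \<equiv> passage_prob (pmf p {-1}) 0" and "g \<equiv> passage_prob (pmf p {1}) 0"
  shows "measure_pmf.prob (replicate_pmf (2 * n) p) {w. Dyck_N_excursion w} =
    1 - (\<Sum>i<n. f (2 * i + 1)) - (\<Sum>i<n. g (2 * i + 1)) +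
    (\<Sum>j<n. g (2 * j + 1) * (\<Sum>i<n - j. f (2 * i + 1)))"
proof -
  let ?N = "2 * n"
  let ?M = "replicate_pmf ?N p"
  define W where "W = {w. Dyck_N_walk w \<and> length w = ?N}"
  define E where "E k = {w \<in> W. first_passage 0 (take k (map Max w))}" for k
  define F where "F l = {w \<in> W. first_passage 0 (take l (map (\<lambda>s. - Min s) (rev w)))}" for l
  have W: "set_pmf ?M \<subseteq> W"
    using p by (auto simp: W_def set_replicate_pmf Dyck_N_walk_def)
  have up: "measure_pmf.prob (replicate_pmf k p) {w. first_passage 0 (map Max w)} = f k" for k
    unfolding f_def by (intro prob_map_first_passage map_Max_Dyck_N_step_pmf p)
  have down: "measure_pmf.prob (replicate_pmf k p) {w. first_passage 0 (map (\<lambda>s. - Min s) w)} = g k" for k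
    unfolding g_def by (intro prob_map_first_passage map_neg_Min_Dyck_N_step_pmf p)
  have f0: "f k = 0" and g0: "g k = 0" if "even k" for k
    unfolding f_def g_def using that by (auto intro!: passage_prob_parity simp: pmf_le_1)
  have E: "measure_pmf.prob ?M (E k) = f k" if "k \<le> ?N" for k
  proof -
    have "measure_pmf.prob ?M (E k) =
        measure_pmf.prob ?M {w. first_passage 0 (map Max (take k w))}"
      by (rule measure_prob_cong_0) (use W in \<open>auto simp: E_def take_map pmf_eq_0_set_pmf\<close>)
    also have "\<dots> = f k" using prob_replicate_pmf_take[OF that, of p "\<lambda>v. first_passage 0 (map Max v)"] up by simp
    finally show ?thesis .
  qed
  have F: "measure_pmf.prob ?M (F l) = g l" if "l \<le> ?N" for l
  proof -
    have "measure_pmf.prob ?M (F l) =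
        measure_pmf.prob ?M {w. first_passage 0 (map (\<lambda>s. - Min s) (take l (rev w)))}"
      by (rule measure_prob_cong_0) (use W in \<open>auto simp: F_def take_map pmf_eq_0_set_pmf\<close>)
    also have "\<dots> = g l" using prob_replicate_pmf_take_rev[OF that, of p "\<lambda>v. first_passage 0 (map (\<lambda>s. - Min s) v)"] down by simp
    finally show ?thesis .
  qed
  have EF: "measure_pmf.prob ?M (E k \<inter> F l) = (if k + l \<le> ?N then f k * g l else 0)"
    if "k \<le> ?N" "l \<le> ?N" for k l
  proof (cases "k + l \<le> ?N")
    case True
    have "measure_pmf.prob ?M (E k \<inter> F l) =
        measure_pmf.prob ?M {w. first_passage 0 (map Max (take k w)) \<and>
          first_passage 0 (map (\<lambda>s. - Min s) (take l (rev w)))}"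
      by (rule measure_prob_cong_0) (use W in \<open>auto simp: E_def F_def take_map pmf_eq_0_set_pmf\<close>)
    also have "\<dots> = f k * g l" 
      using prob_replicate_pmf_both_ends[OF True, of p "\<lambda>v. first_passage 0 (map Max v)"
          "\<lambda>v. first_passage 0 (map (\<lambda>s. - Min s) v)"] up down by simp
    finally show ?thesis using True by simp
  next
    case False
    then have "E k \<inter> F l = {}"
      using first_passages_no_overlap[of _ k l] that by (force simp: E_def F_def W_def)
    then show ?thesis using False by simp
  qed
  have disj: "disjoint_family_on E {..?N}" "disjoint_family_on F {..?N}"
    unfolding disjoint_family_on_def
    by (auto simp: E_def F_def W_def dest: first_passage_unique)
  have "measure_pmf.prob ?M (\<Union>k\<le>?N. E k) = (\<Sum>k\<le>?N. f k)"
    using disj by (subst measure_pmf.finite_measure_finite_Union) (auto simp: E)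
  moreover have "measure_pmf.prob ?M (\<Union>l\<le>?N. F l) = (\<Sum>l\<le>?N. g l)"
    using disj by (subst measure_pmf.finite_measure_finite_Union) (auto simp: F)
  moreover have "measure_pmf.prob ?M ((\<Union>k\<le>?N. E k) \<inter> (\<Union>l\<le>?N. F l)) =
      (\<Sum>k\<le>?N. \<Sum>l\<le>?N. if k + l \<le> ?N then f k * g l else 0)"
  proof -
    have eq: "(\<Union>k\<le>?N. E k) \<inter> (\<Union>l\<le>?N. F l) = (\<Union>(k, l) \<in> {..?N} \<times> {..?N}. E k \<inter> F l)"
      by auto
    have "disjoint_family_on (\<lambda>(k, l). E k \<inter> F l) ({..?N} \<times> {..?N})"
      using disj unfolding disjoint_family_on_def by fastforce
    then have "measure_pmf.prob ?M ((\<Union>k\<le>?N. E k) \<inter> (\<Union>l\<le>?N. F l)) =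
        (\<Sum>(k, l) \<in> {..?N} \<times> {..?N}. measure_pmf.prob ?M (E k \<inter> F l))"
      unfolding eq
      by (subst measure_pmf.finite_measure_finite_Union) (auto simp: case_prod_beta)
    also have "\<dots> = (\<Sum>k\<le>?N. \<Sum>l\<le>?N. measure_pmf.prob ?M (E k \<inter> F l))"
      by (simp add: sum.cartesian_product)
    finally show ?thesis using EF by simp
  qed
  moreover have "measure_pmf.prob ?M {w. Dyck_N_excursion w} =
      1 - measure_pmf.prob ?M ((\<Union>k\<le>?N. E k) \<union> (\<Union>l\<le>?N. F l))"
  proof -
    have bad: "w \<in> (\<Union>k\<le>?N. E k) \<union> (\<Union>l\<le>?N. F l) \<longleftrightarrow> \<not> Dyck_N_excursion w" if "w \<in> W" for w
    proof -
      have "Dyck_N_walk w" "length w = ?N" using that by (auto simp: W_def)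
      then show ?thesis
        using that not_stays_nonneg_iff[of "map Max w"] not_stays_nonneg_iff[of "map (\<lambda>s. - Min s) (rev w)"]
        by (subst Dyck_N_excursion_iff) (auto simp: E_def F_def)
    qed
    have "measure_pmf.prob ?M {w. Dyck_N_excursion w} =
        measure_pmf.prob ?M (space ?M - ((\<Union>k\<le>?N. E k) \<union> (\<Union>l\<le>?N. F l)))"
      by (rule measure_prob_cong_0) (use W bad in \<open>auto simp: pmf_eq_0_set_pmf\<close>)
    then show ?thesis by (simp only: measure_pmf.prob_compl sets_measure_pmf UNIV_I)
  qed
  ultimately show ?thesis
    using double_sum_odd_indices[of f g n, OF f0 g0] sum_odd_indices[of f n, OF f0] sum_odd_indices[of g n, OF g0]
    by (simp add: measure_Un3 measure_pmf.fmeasurable_eq_sets)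
qed

text \<open>With steps 1 and -1 a first passage cannot overshoot: it ends with a down-step from
  height 0.\<close>

lemma first_passage_append_iff:
  assumes "x = -1 \<or> x = 1"
  shows "first_passage 0 (v @ [x]) \<longleftrightarrow> excursion v \<and> x = -1"
proof
  assume fp: "first_passage 0 (v @ [x])"
  have "0 \<le> sum_list (take k v)" if "k \<le> length v" for k
    using fp that by (auto simp: first_passage_iff dest!: spec[of _ k])
  moreover from this[of "length v"] have "sum_list v = 0 \<and> x = -1"
    using fp assms by (auto simp: first_passage_iff)
  ultimately show "excursion v \<and> x = -1" by (simp add: excursion_def)
qed (auto simp: first_passage_iff excursion_def)

text \<open>Without the step \<open>{-1, 1}\<close> the walk is deterministic given the N-walk, and an excursion
  followed by a down-step is a first passage to \<open>-1\<close>.\<close>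

lemma prob_Dyck_N_excursion_deterministic:
  fixes p :: "int set pmf"
  assumes p: "set_pmf p \<subseteq> {{-1}, {1}}"
  defines "q \<equiv> pmf p {-1}"
  assumes "0 < q"
  shows "measure_pmf.prob (replicate_pmf (2 * n) p) {w. Dyck_N_excursion w} =
    catalan_weight n * (4 * q * (1 - q)) ^ n"
proof -
  have steps: "set_pmf p \<subseteq> Dyck_N_steps"
    using p by (auto simp: Dyck_N_steps_def)
  let ?M = "\<lambda>n. replicate_pmf n p"
  have exc: "Dyck_N_excursion w \<longleftrightarrow> excursion (map Max w)" if "set w \<subseteq> {{-1}, {1}}" for w
  proof -
    have "compatible v w \<longleftrightarrow> v = map Max w" for v
      using that unfolding compatible_def
      by (induction w arbitrary: v) (fastforce simp: list_all2_Cons2)+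
    moreover have "Dyck_N_walk w"
      using that by (auto simp: Dyck_N_walk_def Dyck_N_steps_def)
    ultimately show ?thesis by (simp add: Dyck_N_excursion_def)
  qed
  \<comment> \<open>The factor \<open>q\<close> is the probability of the appended down-step. It is
    cancelled at the end, hence \<open>0 < q\<close>.\<close>
  have "q * catalan_weight n * (4 * q * (1 - q)) ^ n = passage_prob q 0 (2 * n + 1)"
    using \<open>0 < q\<close> by (subst passage_prob_catalan) (auto simp: q_def pmf_le_1)
  also have "\<dots> = measure_pmf.prob (?M (2 * n + 1)) {w. first_passage 0 (map Max w)}"
    unfolding q_def by (intro prob_map_first_passage[symmetric] map_Max_Dyck_N_step_pmf steps)
  also have "\<dots> = measure_pmf.prob (?M (2 * n + 1))
      {w. Dyck_N_excursion (take (2 * n) w) \<and> drop (2 * n) w = [{-1}]}"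
  proof -
    have "first_passage 0 (map Max w) \<longleftrightarrow>
        Dyck_N_excursion (take (2 * n) w) \<and> drop (2 * n) w = [{-1}]"
      if "w \<in> set_pmf (?M (2 * n + 1))" for w
    proof -
      have len: "length w = Suc (2 * n)" and "set w \<subseteq> set_pmf p"
        using that by (auto simp: set_replicate_pmf)
      with p have w: "set w \<subseteq> {{-1}, {1}}" by blast
      obtain u s where us: "w = u @ [s]" "length u = 2 * n"
        using len by (cases w rule: rev_cases) auto
      with w have "set u \<subseteq> {{-1}, {1}}" "s = {-1} \<or> s = {1}" by auto
      then show ?thesis
        using us first_passage_append_iff[of "Max s" "map Max u"] by (auto simp: exc)
    qed
    then show ?thesis
      by (intro measure_prob_cong_0) (auto simp: pmf_eq_0_set_pmf)
  qed
  also have "\<dots> = measure_pmf.prob (?M (2 * n)) {w. Dyck_N_excursion w} *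
      measure_pmf.prob (?M 1) {w. w = [{-1}]}"
    by (rule prob_replicate_pmf_add)
  also have "measure_pmf.prob (?M 1) {w. w = [{-1}]} = q"
  proof -
    have "(\<lambda>s. [s]) -` {w. w = [{-1}]} = {{-1 :: int}}" by auto
    then show ?thesis by (simp only: replicate_pmf_1 measure_map_pmf measure_pmf_single q_def)
  qed
  finally show ?thesis using \<open>0 < q\<close> by (simp add: mult_ac)
qed

section \<open>Generating function of the Catalan weights\<close>

text \<open>The square times \<open>n + 1\<close> starts at 1 and does not increase, because
  \<open>(2 * n + 1) ^ 2 * (n + 2) \<le> 4 * (n + 1) ^ 3\<close>.\<close>

lemma central_binomial_weight_le: "central_binomial_weight n \<le> 1 / sqrt (n + 1)"
proof -
  have "central_binomial_weight n ^ 2 * (n + 1) \<le> 1"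
  proof (induction n)
    case (Suc n)
    have "central_binomial_weight (Suc n) ^ 2 * (Suc n + 1) =
        (central_binomial_weight n ^ 2 * (n + 1)) * (((2 * real n + 1) ^ 2 * (n + 2)) / (4 * (n + 1) ^ 3))"
      by (simp add: central_binomial_weight_Suc divide_simps) (simp add: power2_eq_square power3_eq_cube algebra_simps)
    also have "\<dots> \<le> 1 * 1"
    proof (intro mult_mono Suc)
      have "(2 * real n + 1) ^ 2 * (n + 2) \<le> 4 * (n + 1) ^ 3"
        by (simp add: power2_eq_square power3_eq_cube algebra_simps)
      then show "((2 * real n + 1) ^ 2 * (n + 2)) / (4 * (n + 1) ^ 3) \<le> 1"
        by simp
    qed auto
    finally show ?case by simp
  qed simp
  then have "sqrt (central_binomial_weight n ^ 2 * (n + 1)) \<le> 1"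
    by simp
  then have "central_binomial_weight n * sqrt (n + 1) \<le> 1"
    using central_binomial_weight_pos[of n] unfolding real_sqrt_mult by simp
  then show ?thesis by (simp add: field_simps)
qed

lemma central_binomial_weight_tendsto_0: "central_binomial_weight \<longlonglongrightarrow> 0"
proof (rule tendsto_sandwich[of "\<lambda>_. 0"])
  show "(\<lambda>n. 1 / sqrt (real n + 1)) \<longlonglongrightarrow> 0" by real_asymp
  show "\<forall>\<^sub>F n in sequentially. central_binomial_weight n \<le> 1 / sqrt (real n + 1)"
    using central_binomial_weight_le by (simp add: add.commute)
qed (auto simp: less_imp_le central_binomial_weight_pos)

text \<open>Coefficients of \<open>sqrt (1 - x)\<close> beyond the constant term; both sides obey
  the recurrence with ratio \<open>(2 * n + 1) / (2 * n + 4)\<close>.\<close>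

lemma catalan_weight_gbinomial:
  "((1/2 :: real) gchoose Suc n) * (-1) ^ Suc n = - catalan_weight n / 2"
proof (induction n)
  case (Suc n)
  let ?g = "\<lambda>n. (1/2 :: real) gchoose n"
  have "1/2 * ?g (Suc n) = (n + 1) * ?g (Suc n) + (n + 2) * ?g (Suc (Suc n))"
    using gbinomial_mult_1[of "1/2 :: real" "Suc n"] by simp
  define c where "c = (2 * real n + 1) / (2 * real n + 4)"
  have "?g (Suc (Suc n)) = - c * ?g (Suc n)"
    using \<open>1/2 * ?g (Suc n) = _\<close> by (simp add: c_def field_simps)
  then have "?g (Suc (Suc n)) * (-1) ^ Suc (Suc n) = c * (?g (Suc n) * (-1) ^ Suc n)"
    by simp
  then show ?case unfolding Suc by (simp add: catalan_weight_Suc c_def)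
qed simp

text \<open>The usual \<open>2 * (1 - sqrt (1 - x)) / x\<close>, rationalised so that
  \<open>x = 0\<close> is included.\<close>

lemma catalan_weight_sums:
  assumes "0 \<le> x" "x \<le> 1"
  shows "(\<lambda>i. catalan_weight i * x ^ i) sums (2 / (1 + sqrt (1 - x)))"
proof -
  consider "x = 0" | "x = 1" | "0 < x" "x < 1" using assms by linarith
  then show ?thesis
  proof cases
    case 1
    then show ?thesis using powser_sums_zero[of catalan_weight] by simp
  next
    \<comment> \<open>The binomial series is applied inside the unit disc only; at its boundary
      point the series telescopes.\<close>
    case 2
    have "(\<lambda>i. central_binomial_weight i - central_binomial_weight (Suc i)) sums (1 - 0)"
      using telescope_sums'[OF central_binomial_weight_tendsto_0] by simp
    then have "(\<lambda>i. 2 * (central_binomial_weight i - central_binomial_weight (Suc i))) sums (2 * (1 - 0))"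
      by (rule sums_mult)
    with 2 show ?thesis by (simp add: catalan_weight_telescope)
  next
    case 3
    have "(\<lambda>n. ((1/2) gchoose n) * (- x) ^ n) sums sqrt (1 + - x)"
      by (rule sqrt_series) (use 3 in simp)
    then have "(\<lambda>n. ((1/2) gchoose Suc n) * (- x) ^ Suc n) sums (sqrt (1 - x) - 1)"
      by (subst sums_Suc_iff) simp
    moreover have "((1/2) gchoose Suc n) * (- x) ^ Suc n = - (x / 2) * (catalan_weight n * x ^ n)" for n
    proof -
      have "((1/2) gchoose Suc n) * (- x) ^ Suc n = (((1/2) gchoose Suc n) * (- 1) ^ Suc n) * x ^ Suc n"
        by (subst power_minus) (simp only: mult_ac)
      then show ?thesis unfolding catalan_weight_gbinomial by simp
    qed
    ultimately have "(\<lambda>n. - (x / 2) * (catalan_weight n * x ^ n)) sums (sqrt (1 - x) - 1)"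
      by (simp only:)
    then have "(\<lambda>n. - (2 / x) * (- (x / 2) * (catalan_weight n * x ^ n))) sums (- (2 / x) * (sqrt (1 - x) - 1))"
      by (rule sums_mult)
    moreover have "- (2 / x) * (sqrt (1 - x) - 1) = 2 / (1 + sqrt (1 - x))"
    proof -
      have "(1 - sqrt (1 - x)) * (1 + sqrt (1 - x)) = x"
        using 3 by (simp add: algebra_simps)
      moreover have "1 + sqrt (1 - x) \<noteq> 0"
        using 3 by (smt (verit) real_sqrt_ge_zero)
      ultimately show ?thesis using 3 by (simp add: divide_simps) (simp add: algebra_simps)
    qed
    moreover have "- (2 / x) * (- (x / 2) * (catalan_weight n * x ^ n)) = catalan_weight n * x ^ n" for n
      using 3 by simp
    ultimately show ?thesis by simp
  qed
qed

lemma four_mult_le_one: "4 * q * (1 - q) \<le> (1 :: real)"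
  using zero_le_power2[of "2 * q - 1"] by (simp add: power2_eq_square algebra_simps)

lemma four_mult_less_one:
  assumes "q \<noteq> 1 / 2"
  shows "4 * q * (1 - q) < (1 :: real)"
proof -
  have "0 < (2 * q - 1) ^ 2" using assms by (simp add: field_simps)
  then show ?thesis by (simp add: power2_eq_square algebra_simps)
qed

text \<open>The ruin probability of the walk. The two cases come from
  \<open>sqrt (1 - 4 * q * (1 - q)) = \<bar>1 - 2 * q\<bar>\<close>.\<close>

lemma passage_sums:
  fixes q :: real
  assumes "0 \<le> q" "q \<le> 1"
  shows "(\<lambda>i. q * catalan_weight i * (4 * q * (1 - q)) ^ i) sums (if q \<le> 1/2 then q / (1 - q) else 1)"
proof -
  have "sqrt (1 - 4 * q * (1 - q)) = sqrt ((1 - 2 * q) ^ 2)"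
    by (simp add: power2_eq_square algebra_simps)
  then have s: "sqrt (1 - 4 * q * (1 - q)) = \<bar>1 - 2 * q\<bar>" by simp
  have "(\<lambda>i. q * (catalan_weight i * (4 * q * (1 - q)) ^ i)) sums (q * (2 / (1 + \<bar>1 - 2 * q\<bar>)))"
    using catalan_weight_sums[of "4 * q * (1 - q)"] four_mult_le_one[of q] assms
    unfolding s by (intro sums_mult) simp
  moreover have "q * (2 / (1 + \<bar>1 - 2 * q\<bar>)) = (if q \<le> 1/2 then q / (1 - q) else 1)"
    using assms by (auto simp: divide_simps)
  ultimately show ?thesis by (simp only: mult.assoc)
qed

text \<open>Each inner partial sum is \<open>A\<close> minus a tail. The form is deliberately
  asymmetric: for \<open>A = 1\<close> just the tail of \<open>f\<close> and one convolution
  survive.\<close>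

lemma inclusion_exclusion_tails:
  fixes f g :: "nat \<Rightarrow> real"
  assumes f: "f sums A" and g: "g sums B"
  shows "1 - (\<Sum>i<n. f i) - (\<Sum>i<n. g i) + (\<Sum>j<n. g j * (\<Sum>i<n - j. f i)) =
    (1 - A) * (1 - B) + (1 - A) * (\<Sum>i. g (i + n)) + (\<Sum>i. f (i + n)) -
    (\<Sum>j<n. g j * (\<Sum>i. f (i + (n - j))))"
proof -
  have f': "(\<Sum>i<m. f i) = A - (\<Sum>i. f (i + m))" for m
    using suminf_split_initial_segment[of f m] f by (simp add: sums_iff)
  have g': "(\<Sum>i<m. g i) = B - (\<Sum>i. g (i + m))" for m
    using suminf_split_initial_segment[of g m] g by (simp add: sums_iff)
  have "(\<Sum>j<n. g j * (\<Sum>i<n - j. f i)) =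
      A * (\<Sum>j<n. g j) - (\<Sum>j<n. g j * (\<Sum>i. f (i + (n - j))))"
    by (simp add: f' right_diff_distrib sum_subtractf sum_distrib_left mult.commute)
  then show ?thesis by (simp add: f' g' algebra_simps)
qed

section \<open>Asymptotic tools\<close>

lemma central_binomial_weight_wallis:
  "(\<Prod>k=1..n. (4 * real k ^ 2) / (4 * real k ^ 2 - 1)) = 1 / (central_binomial_weight n ^ 2 * (2 * n + 1))"
proof (induction n)
  case (Suc n)
  let ?f = "\<lambda>k. (4 * real k ^ 2) / (4 * real k ^ 2 - 1)"
  have "?f (Suc n) = 4 * (n + 1) ^ 2 / ((2 * n + 1) * (2 * n + 3))"
    by (simp add: power2_eq_square algebra_simps)
  moreover have "prod ?f {1..Suc n} = prod ?f {1..n} * ?f (Suc n)"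
    by simp
  ultimately have "prod ?f {1..Suc n} =
      1 / (central_binomial_weight n ^ 2 * (2 * n + 1)) * (4 * (n + 1) ^ 2 / ((2 * n + 1) * (2 * n + 3)))"
    by (simp only: Suc)
  also have "\<dots> = 1 / (central_binomial_weight (Suc n) ^ 2 * (2 * Suc n + 1))"
    using central_binomial_weight_pos[of n]
    by (simp add: central_binomial_weight_Suc divide_simps add_nonneg_eq_0_iff)
       (simp add: power2_eq_square algebra_simps)
  finally show ?case .
qed simp

text \<open>The square times \<open>n\<close> increases and the square times \<open>n + 1/2\<close>
  decreases, both to \<open>1 / pi\<close> by Wallis; each bound compares a monotone sequence with
  its limit.\<close>

lemma central_binomial_weight_bounds:
  assumes "0 < n"
  shows "central_binomial_weight n ^ 2 \<le> 1 / (pi * n)"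
    and "1 / (pi * (n + 1/2)) \<le> central_binomial_weight n ^ 2"
proof -
  let ?b = "\<lambda>n. central_binomial_weight n ^ 2"
  have wallis': "(\<lambda>n. 1 / (?b n * (2 * n + 1))) \<longlonglongrightarrow> pi / 2"
    using wallis unfolding central_binomial_weight_wallis .
  have "(\<lambda>n. 1 / 2 * inverse (1 / (?b n * (2 * n + 1)))) \<longlonglongrightarrow> 1 / 2 * inverse (pi / 2)"
    by (intro tendsto_mult tendsto_const tendsto_inverse wallis') simp
  then have up: "(\<lambda>n. ?b n * (n + 1/2)) \<longlonglongrightarrow> 1 / pi"
    by (rule filterlim_cong[THEN iffD1, rotated -1]) (auto simp: algebra_simps)
  have "(\<lambda>n. ?b n * (n + 1/2) * (real n / (n + 1/2))) \<longlonglongrightarrow> 1 / pi * 1"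
    by (intro tendsto_mult up) real_asymp
  then have low: "(\<lambda>n. ?b n * n) \<longlonglongrightarrow> 1 / pi"
    by (rule filterlim_cong[THEN iffD1, rotated -1]) (auto simp: add_pos_pos)
  have "incseq (\<lambda>n. ?b n * n)"
  proof (rule incseq_SucI)
    fix n
    have "?b (Suc n) * real (Suc n) = ?b n * ((2 * real n + 1) ^ 2 / (4 * (real n + 1)))"
      by (simp add: central_binomial_weight_Suc divide_simps) (simp add: power2_eq_square algebra_simps)
    moreover have "real n \<le> (2 * real n + 1) ^ 2 / (4 * (real n + 1))"
      by (simp add: divide_simps power2_eq_square) (simp add: algebra_simps)
    ultimately show "?b n * n \<le> ?b (Suc n) * real (Suc n)"
      by (simp only: mult_left_mono zero_le_power2)
  qed
  from incseq_le[OF this low, of n] assms show "?b n \<le> 1 / (pi * n)"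
    by (simp add: field_simps)
  have "decseq (\<lambda>n. ?b n * (n + 1/2))"
  proof (rule decseq_SucI)
    fix n
    have "?b (Suc n) * (Suc n + 1/2) = ?b n * ((2 * real n + 1) ^ 2 * (n + 3/2) / (4 * (real n + 1) ^ 2))"
      by (simp add: central_binomial_weight_Suc divide_simps) (simp add: power2_eq_square algebra_simps)
    moreover have "(2 * real n + 1) ^ 2 * (n + 3/2) / (4 * (real n + 1) ^ 2) \<le> n + 1/2"
      by (subst pos_divide_le_eq) (simp_all add: power2_eq_square algebra_simps add_pos_nonneg)
    ultimately show "?b (Suc n) * (Suc n + 1/2) \<le> ?b n * (n + 1/2)"
      by (simp only: mult_left_mono zero_le_power2)
  qed
  from decseq_ge[OF this up, of n] assms show "1 / (pi * (n + 1/2)) \<le> ?b n"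
    by (simp add: field_simps add_pos_pos)
qed

text \<open>The upper and lower bounds just obtained already differ by no more than the error
  term.\<close>

lemma central_binomial_weight_asymp:
  "(\<lambda>n. central_binomial_weight n - 1 / sqrt (pi * real n)) \<in> O(\<lambda>n. real n powr (-3/2))"
proof -
  have "norm (central_binomial_weight n - 1 / sqrt (pi * real n)) \<le>
      norm (sqrt (1 / (pi * real n)) - sqrt (1 / (pi * (real n + 1/2))))" if "0 < n" for n
  proof -
    have "sqrt (1 / (pi * (real n + 1/2))) \<le> sqrt (central_binomial_weight n ^ 2)"
      by (rule real_sqrt_le_mono) (use central_binomial_weight_bounds[OF that] in simp)
    moreover have "sqrt (central_binomial_weight n ^ 2) \<le> sqrt (1 / (pi * real n))"
      by (rule real_sqrt_le_mono) (use central_binomial_weight_bounds[OF that] in simp)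
    moreover have "sqrt (central_binomial_weight n ^ 2) = central_binomial_weight n"
      using central_binomial_weight_pos[of n] by simp
    ultimately show ?thesis by (simp add: real_sqrt_divide)
  qed
  then have "(\<lambda>n. central_binomial_weight n - 1 / sqrt (pi * real n)) \<in>
      O(\<lambda>n. sqrt (1 / (pi * real n)) - sqrt (1 / (pi * (real n + 1/2))))"
    by (intro landau_o.big_mono eventually_mono[OF eventually_gt_at_top[of 0]]) 
  also have "(\<lambda>n. sqrt (1 / (pi * real n)) - sqrt (1 / (pi * (real n + 1/2)))) \<in> O(\<lambda>n. real n powr (-3/2))"
    by real_asymp
  finally show ?thesis .
qed

lemma catalan_weight_asymp:
  "(\<lambda>n. catalan_weight n - 1 / sqrt (pi * real n ^ 3)) \<in> O(\<lambda>n. real n powr (-5/2))"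
proof -
  have "(\<lambda>n. (central_binomial_weight n - 1 / sqrt (pi * real n)) * (1 / (n + 1))) \<in>
      O(\<lambda>n. real n powr (-3/2) * (1 / real n))"
    by (intro landau_o.big.mult central_binomial_weight_asymp) real_asymp
  also have "(\<lambda>n. real n powr (-3/2) * (1 / real n)) \<in> O(\<lambda>n. real n powr (-5/2))"
    by real_asymp
  finally have "(\<lambda>n. (central_binomial_weight n - 1 / sqrt (pi * real n)) * (1 / (n + 1))) \<in>
      O(\<lambda>n. real n powr (-5/2))" .
  moreover have "(\<lambda>n. 1 / sqrt (pi * real n) * (1 / (n + 1)) - 1 / sqrt (pi * real n ^ 3)) \<in>
      O(\<lambda>n. real n powr (-5/2))"
    by real_asymp
  ultimately have "(\<lambda>n. (central_binomial_weight n - 1 / sqrt (pi * real n)) * (1 / (n + 1)) +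
      (1 / sqrt (pi * real n) * (1 / (n + 1)) - 1 / sqrt (pi * real n ^ 3))) \<in> O(\<lambda>n. real n powr (-5/2))"
    by (rule sum_in_bigo)
  then show ?thesis
    by (simp add: catalan_weight_eq algebra_simps add_divide_distrib diff_divide_distrib)
qed

lemma catalan_weight_le: "catalan_weight n \<le> real (n + 1) powr (-3/2)"
proof -
  have "catalan_weight n \<le> 1 / sqrt (n + 1) / (n + 1)"
    unfolding catalan_weight_eq by (intro divide_right_mono central_binomial_weight_le) simp
  also have "\<dots> = real (n + 1) powr (-1/2 - 1)"
    unfolding powr_diff by (simp add: powr_minus_divide powr_half_sqrt)
  finally show ?thesis by simp
qed

lemma catalan_weight_decreasing: "catalan_weight (Suc n) \<le> catalan_weight n"
  using catalan_weight_pos[of n] by (simp add: catalan_weight_Suc field_simps)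

lemma catalan_weight_diff_le:
  "\<bar>catalan_weight n - catalan_weight (Suc n)\<bar> \<le> 2 * real (n + 1) powr (-3/2 - 1)"
proof -
  have "catalan_weight n - catalan_weight (Suc n) = catalan_weight n * (3 / (2 * n + 4))"
    by (simp add: catalan_weight_Suc field_simps)
  also have "\<dots> \<le> real (n + 1) powr (-3/2) * (2 / (n + 1))"
    by (intro mult_mono catalan_weight_le) (auto simp: field_simps)
  also have "\<dots> = 2 * real (n + 1) powr (-3/2 - 1)"
    unfolding powr_diff by simp
  finally show ?thesis
    using catalan_weight_decreasing[of n] by simp
qed

section \<open>Extracting a slowly varying factor from a sum\<close>

lemma diff_le_of_step_bound:
  fixes g :: "nat \<Rightarrow> real"
  assumes step: "\<And>n. \<bar>g n - g (Suc n)\<bar> \<le> K * real (n + 1) powr (-t)" and "0 \<le> t" "m \<le> n"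
  shows "\<bar>g m - g n\<bar> \<le> real (n - m) * (K * real (m + 1) powr (-t))"
  using \<open>m \<le> n\<close>
proof (induction n rule: dec_induct)
  case (step n)
  have "0 \<le> K" using assms(1)[of 0] by simp
  have "\<bar>g n - g (Suc n)\<bar> \<le> K * real (n + 1) powr (-t)" by (rule assms(1))
  also have "\<dots> \<le> K * real (m + 1) powr (-t)"
    using step.hyps \<open>0 \<le> t\<close> \<open>0 \<le> K\<close> by (intro mult_left_mono powr_mono2') auto
  finally have "\<bar>g n - g (Suc n)\<bar> \<le> K * real (m + 1) powr (-t)" .
  moreover have "real (Suc n - m) = real (n - m) + 1" using step.hyps by simp
  ultimately show ?case using step.IH by (simp add: distrib_right)
qed simp

text \<open>Dominated convergence with a rate. The power 4 is what convolutions need: one factor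
  \<open>j + 1\<close> from moving \<open>j\<close> steps and three from comparing decay at
  \<open>n - j\<close> with decay at \<open>n\<close>, for exponents up to 3.\<close>

lemma weighted_sum_asymp:
  fixes b g :: "nat \<Rightarrow> real" and h :: "nat \<Rightarrow> nat \<Rightarrow> real"
  assumes b: "summable (\<lambda>j. \<bar>b j\<bar> * real (j + 1) ^ 4)" and "0 \<le> t"
    and h: "\<And>n j. \<bar>h n j - g n\<bar> \<le> K * real (j + 1) ^ 4 * real (n + 1) powr (-t)"
  shows "(\<lambda>n. (\<Sum>j. b j * h n j) - (\<Sum>j. b j) * g n) \<in> O(\<lambda>n. real n powr (-t))"
    and "summable (\<lambda>j. b j * h n j)"
proof -
  have sb: "summable b"
  proof (rule summable_comparison_test'[OF b, of 0])
    fix j show "norm (b j) \<le> \<bar>b j\<bar> * real (j + 1) ^ 4"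
      using mult_left_mono[OF one_le_power[of "real (j + 1)" 4], of "\<bar>b j\<bar>"] by simp
  qed
  have weighted: "\<bar>b j * (h n j - g n)\<bar> \<le> K * real (n + 1) powr (-t) * (\<bar>b j\<bar> * real (j + 1) ^ 4)" for n j
    using mult_left_mono[OF h[of n j], of "\<bar>b j\<bar>"] by (simp add: abs_mult mult_ac)
  have sd: "summable (\<lambda>j. \<bar>b j * (h n j - g n)\<bar>)" for n
    by (rule summable_comparison_test'[OF summable_mult[OF b], of 0]) (use weighted in simp)
  have "summable (\<lambda>j. b j * (h n j - g n) + b j * g n)" for n
    by (rule summable_add[OF summable_rabs_cancel[OF sd] summable_mult2[OF sb]])
  then show sh: "summable (\<lambda>j. b j * h n j)" for n
    by (simp add: right_diff_distrib)
  define S where "S = (\<Sum>j. \<bar>b j\<bar> * real (j + 1) ^ 4)"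
  have "\<bar>(\<Sum>j. b j * h n j) - (\<Sum>j. b j) * g n\<bar> \<le> K * S * real n powr (-t)" if "0 < n" for n
  proof -
    have "(\<Sum>j. b j * h n j) - (\<Sum>j. b j) * g n = (\<Sum>j. b j * (h n j - g n))"
      using suminf_diff[OF sh summable_mult2[OF sb, of "g n"]] suminf_mult2[OF sb, of "g n"]
      by (simp add: right_diff_distrib)
    also have "\<bar>\<dots>\<bar> \<le> (\<Sum>j. \<bar>b j * (h n j - g n)\<bar>)"
      by (intro summable_rabs sd)
    also have "\<dots> \<le> (\<Sum>j. K * real (n + 1) powr (-t) * (\<bar>b j\<bar> * real (j + 1) ^ 4))"
      by (intro suminf_le weighted sd summable_mult b)
    also have "\<dots> = K * S * real (n + 1) powr (-t)"
      using suminf_mult[OF b, of "K * real (n + 1) powr (-t)"] by (simp add: S_def)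
    also have "\<dots> \<le> K * S * real n powr (-t)"
    proof (intro mult_left_mono powr_mono2' mult_nonneg_nonneg)
      have "0 \<le> K * real (0 + 1) ^ 4 * real (0 + 1) powr (-t)"
        using h[of 0 0] by (meson abs_ge_zero order_trans)
      then show "0 \<le> K" by simp
      show "0 \<le> S" unfolding S_def by (intro suminf_nonneg b) simp
    qed (use that \<open>0 \<le> t\<close> in auto)
    finally show ?thesis .
  qed
  then show "(\<lambda>n. (\<Sum>j. b j * h n j) - (\<Sum>j. b j) * g n) \<in> O(\<lambda>n. real n powr (-t))"
    by (intro bigoI[of _ "K * S"] eventually_mono[OF eventually_gt_at_top[of 0]]) simp
qed

lemma shifted_sum_asymp:
  fixes b g :: "nat \<Rightarrow> real"
  assumes b: "summable (\<lambda>j. \<bar>b j\<bar> * real (j + 1) ^ 4)" and "0 \<le> t"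
    and step: "\<And>n. \<bar>g n - g (Suc n)\<bar> \<le> K * real (n + 1) powr (-t)"
  shows "(\<lambda>n. (\<Sum>j. b j * g (n + j)) - (\<Sum>j. b j) * g n) \<in> O(\<lambda>n. real n powr (-t))"
    and "summable (\<lambda>j. b j * g (n + j))"
proof -
  have K: "0 \<le> K" using step[of 0] by simp
  have *: "\<bar>g (n + j) - g n\<bar> \<le> K * real (j + 1) ^ 4 * real (n + 1) powr (-t)" for n j
  proof -
    have "\<bar>g n - g (n + j)\<bar> \<le> real j * (K * real (n + 1) powr (-t))"
      using diff_le_of_step_bound[OF step \<open>0 \<le> t\<close>, of n "n + j"] by simp
    also have "\<dots> \<le> real (j + 1) ^ 4 * (K * real (n + 1) powr (-t))"
    proof (rule mult_right_mono)
      have "real j \<le> real (j + 1) ^ 1" by simp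
      also have "\<dots> \<le> real (j + 1) ^ 4" by (rule power_increasing) auto
      finally show "real j \<le> real (j + 1) ^ 4" .
    qed (use K in simp)
    finally show ?thesis by (simp add: abs_minus_commute mult_ac)
  qed
  from weighted_sum_asymp[OF b \<open>0 \<le> t\<close> *]
  show "(\<lambda>n. (\<Sum>j. b j * g (n + j)) - (\<Sum>j. b j) * g n) \<in> O(\<lambda>n. real n powr (-t))"
    and "summable (\<lambda>j. b j * g (n + j))"
    by blast+
qed

text \<open>The inequality \<open>n + 1 \<le> (j + 1) * (n - j + 1)\<close> trades decay at \<open>n - j\<close> for decay at \<open>n\<close>, at the
  cost of powers of \<open>j + 1\<close> that the weights absorb.\<close>

lemma convolution_asymp:
  fixes b g :: "nat \<Rightarrow> real"
  assumes b: "summable (\<lambda>j. \<bar>b j\<bar> * real (j + 1) ^ 4)" and t: "0 \<le> t" "t \<le> 3"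
    and step: "\<And>n. \<bar>g n - g (Suc n)\<bar> \<le> K * real (n + 1) powr (-t)"
    and bound: "\<And>n. \<bar>g n\<bar> \<le> K * real (n + 1) powr (1 - t)"
  shows "(\<lambda>n. (\<Sum>j<n. b j * g (n - j)) - (\<Sum>j. b j) * g n) \<in> O(\<lambda>n. real n powr (-t))"
proof -
  have K: "0 \<le> K" using step[of 0] by simp
  let ?h = "\<lambda>n j. if j < n then g (n - j) else 0"
  have "\<bar>?h n j - g n\<bar> \<le> K * real (j + 1) ^ 4 * real (n + 1) powr (-t)" for n j
  proof (cases "j < n")
    case True
    have "\<bar>g (n - j) - g n\<bar> \<le> real j * (K * real (n - j + 1) powr (-t))"
      using diff_le_of_step_bound[OF step \<open>0 \<le> t\<close>, of "n - j" n] True by simp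
    also have "real (n - j + 1) powr (-t) \<le> real (j + 1) ^ 3 * real (n + 1) powr (-t)"
    proof -
      have "n + 1 \<le> (j + 1) * (n - j + 1)"
      proof -
        obtain d where "n = j + d" using True less_imp_add_positive by blast
        then show ?thesis by simp
      qed
      then have "real (n + 1) \<le> real (j + 1) * real (n - j + 1)"
        by (simp only: of_nat_le_iff flip: of_nat_mult)
      then have "real (n + 1) powr t \<le> real (j + 1) powr t * real (n - j + 1) powr t"
        using t by (simp add: powr_mono2 flip: powr_mult)
      also have "\<dots> \<le> real (j + 1) ^ 3 * real (n - j + 1) powr t"
      proof (rule mult_right_mono)
        have "real (j + 1) powr t \<le> real (j + 1) powr 3"
          using t by (intro powr_mono) auto
        then show "real (j + 1) powr t \<le> real (j + 1) ^ 3" by simp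
      qed simp
      finally show ?thesis by (simp add: powr_minus field_simps)
    qed
    then have "real j * (K * real (n - j + 1) powr (-t)) \<le>
        real (j + 1) * (K * (real (j + 1) ^ 3 * real (n + 1) powr (-t)))"
      using K by (intro mult_mono) auto
    finally show ?thesis using True by (simp add: power_Suc2[symmetric] numeral_eq_Suc mult_ac)
  next
    \<comment> \<open>Beyond the range of summation \<open>?h\<close> is 0 and the error is
      \<open>g n\<close> itself. Here \<open>n + 1 \<le> j + 1\<close>, so one power of
      \<open>n + 1\<close> is paid for by the weights; hence \<open>bound\<close> may be a full
      power weaker than \<open>step\<close>.\<close>
    case False
    have "\<bar>g n\<bar> \<le> K * (real (n + 1) * real (n + 1) powr (-t))"
      using bound[of n] by (simp add: powr_diff powr_minus divide_inverse)
    also have "\<dots> \<le> K * (real (j + 1) ^ 4 * real (n + 1) powr (-t))"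
    proof (intro mult_left_mono mult_right_mono K)
      have "real (n + 1) \<le> real (j + 1) ^ 1" using False by simp
      also have "\<dots> \<le> real (j + 1) ^ 4" by (rule power_increasing) auto
      finally show "real (n + 1) \<le> real (j + 1) ^ 4" .
    qed simp
    finally show ?thesis using False by (simp add: mult_ac)
  qed
  note * = weighted_sum_asymp(1)[OF b t(1) this]
  have "(\<Sum>j. b j * ?h n j) = (\<Sum>j<n. b j * g (n - j))" for n
  proof -
    have "(\<Sum>j. b j * ?h n j) = (\<Sum>j<n. b j * ?h n j)"
      by (rule suminf_finite) auto
    then show ?thesis by simp
  qed
  then show ?thesis using * by simp
qed

lemma summable_geometric_times_power:
  fixes x :: real
  assumes "0 \<le> x" "x < 1"
  shows "summable (\<lambda>j. x ^ j * real (j + 1) ^ 4)"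
proof (cases "x = 0")
  case True
  then show ?thesis
    by (intro summable_finite[of "{0}"]) auto
next
  case False
  define y where "y = (1 + x) / 2"
  have y: "x < y" "y < 1" using assms by (auto simp: y_def)
  have "(\<lambda>j. x ^ j * real (j + 1) ^ 4) \<in> O(\<lambda>j. y ^ j)"
    using False assms y by real_asymp
  then show ?thesis
    by (rule summable_comparison_test_bigo[rotated]) (use assms y in \<open>auto simp: summable_geometric\<close>)
qed

text \<open>One of \<open>j + 1\<close> and \<open>n - j + 1\<close> is at least half of
  \<open>n + 1\<close>. Its power is comparable to that of \<open>n + 1\<close>, with 4 rounding up
  \<open>2 powr (3/2)\<close>, and the other factor is summable.\<close>

lemma convolution_powr_bound:
  obtains C :: real where
    "\<And>n. (\<Sum>j<n. real (j + 1) powr (-3/2) * real (n - j + 1) powr (-3/2)) \<le> C * real (n + 1) powr (-3/2)"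
proof
  let ?w = "\<lambda>j. real (j + 1) powr (-3/2)"
  define S where "S = (\<Sum>j. ?w j)"
  have s: "summable ?w"
    using summable_Suc_iff[of "\<lambda>j. real j powr (-3/2)"] by (simp add: summable_real_powr_iff)
  have partial: "(\<Sum>j\<in>A. ?w j) \<le> S" if "finite A" for A
    unfolding S_def by (intro sum_le_suminf s that) auto
  fix n
  have "?w j * real (n - j + 1) powr (-3/2) \<le> 4 * real (n + 1) powr (-3/2) * (?w j + ?w (n - j))"
    if "j < n" for j
  proof -
    have *: "x powr (-3/2) * y powr (-3/2) \<le> 4 * z powr (-3/2) * (x powr (-3/2) + y powr (-3/2))"
      if "z \<le> 2 * y" "0 < x" "0 < y" "0 < z" for x y z :: real
    proof -
      have "y powr (-3/2) \<le> (z / 2) powr (-3/2)"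
        using that by (intro powr_mono2') auto
      also have "\<dots> = 2 powr (3/2) * z powr (-3/2)"
        using that by (simp add: powr_divide powr_minus field_simps)
      also have "\<dots> \<le> 4 * z powr (-3/2)"
        using powr_mono[of "3/2" 2 "2::real"] by (intro mult_right_mono) auto
      finally have "x powr (-3/2) * y powr (-3/2) \<le> x powr (-3/2) * (4 * z powr (-3/2))"
        by (intro mult_left_mono) auto
      also have "\<dots> \<le> x powr (-3/2) * (4 * z powr (-3/2)) + y powr (-3/2) * (4 * z powr (-3/2))"
        by simp
      finally show ?thesis by (simp add: algebra_simps)
    qed
    show ?thesis
    proof (cases "n + 1 \<le> 2 * (n - j + 1)")
      case True
      then have "real (n + 1) \<le> 2 * real (n - j + 1)" by linarith
      then show ?thesis using *[of "real (n + 1)" "real (n - j + 1)" "real (j + 1)"] by simp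
    next
      case False
      then have "n + 1 \<le> 2 * (j + 1)" using that by arith
      then have "real (n + 1) \<le> 2 * real (j + 1)" by linarith
      then show ?thesis using *[of "real (n + 1)" "real (j + 1)" "real (n - j + 1)"]
        by (simp add: mult_ac add_ac)
    qed
  qed
  then have "(\<Sum>j<n. ?w j * real (n - j + 1) powr (-3/2)) \<le>
      (\<Sum>j<n. 4 * real (n + 1) powr (-3/2) * (?w j + ?w (n - j)))"
    by (intro sum_mono) auto
  also have "\<dots> = 4 * real (n + 1) powr (-3/2) * ((\<Sum>j<n. ?w j) + (\<Sum>j<n. ?w (n - j)))"
    by (simp only: sum.distrib flip: sum_distrib_left)
  also have "(\<Sum>j<n. ?w (n - j)) = (\<Sum>j\<in>{1..n}. ?w j)"
    by (rule sum.reindex_bij_witness[of _ "\<lambda>j. n - j" "\<lambda>j. n - j"]) auto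
  also have "4 * real (n + 1) powr (-3/2) * ((\<Sum>j<n. ?w j) + (\<Sum>j\<in>{1..n}. ?w j)) \<le>
      4 * real (n + 1) powr (-3/2) * (S + S)"
    by (intro mult_left_mono add_mono partial) auto
  finally show "(\<Sum>j<n. ?w j * real (n - j + 1) powr (-3/2)) \<le> 8 * S * real (n + 1) powr (-3/2)"
    by (simp add: mult_ac)
qed

section \<open>The asymptotic regimes\<close>

text \<open>The probability that the walk with down-probability \<open>q\<close> first reaches -1 at
  time \<open>2 * i + 1\<close>.\<close>

definition passage_weight :: "real \<Rightarrow> nat \<Rightarrow> real" where
  "passage_weight q i = q * catalan_weight i * (4 * q * (1 - q)) ^ i"

definition passage_tail :: "real \<Rightarrow> nat \<Rightarrow> real" where
  "passage_tail q n = (\<Sum>i. passage_weight q (i + n))"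

definition excursion_weight :: "real \<Rightarrow> real \<Rightarrow> nat \<Rightarrow> real" where
  "excursion_weight a b n = 1 - (\<Sum>i<n. passage_weight a i) - (\<Sum>i<n. passage_weight b i) +
     (\<Sum>j<n. passage_weight b j * (\<Sum>i<n - j. passage_weight a i))"

text \<open>The double sum runs over the symmetric region \<open>i + j < n\<close>. This is what
  makes the roles of the two singleton steps interchangeable.\<close>

lemma excursion_weight_commute: "excursion_weight a b n = excursion_weight b a n"
proof -
  have "(\<Sum>j<n. g j * (\<Sum>i<n - j. f i)) = (\<Sum>i<n. f i * (\<Sum>j<n - i. g j))" for f g :: "nat \<Rightarrow> real"
  proof -
    have "(\<Sum>j<n. g j * (\<Sum>i<n - j. f i)) = (\<Sum>(j, i)\<in>Sigma {..<n} (\<lambda>j. {..<n - j}). g j * f i)"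
      by (simp add: sum_distrib_left sum.Sigma)
    also have "\<dots> = (\<Sum>(i, j)\<in>Sigma {..<n} (\<lambda>i. {..<n - i}). f i * g j)"
      by (rule sum.reindex_bij_witness[of _ prod.swap prod.swap]) auto
    also have "\<dots> = (\<Sum>i<n. f i * (\<Sum>j<n - i. g j))"
      by (simp add: sum_distrib_left sum.Sigma)
    finally show ?thesis .
  qed
  from this[of "passage_weight b" "passage_weight a"] show ?thesis by (simp add: excursion_weight_def)
qed

lemma set_Dyck_N_step_pmf:
  assumes "0 \<le> p_minus" "0 \<le> p_plus" "0 \<le> p_both" "p_minus + p_plus + p_both = 1"
  shows "set_pmf (Dyck_N_step_pmf p_minus p_plus p_both) \<subseteq> Dyck_N_steps"
proof -
  have "pmf_of_list_wf [({-1::int}, p_minus), ({1}, p_plus), ({-1, 1}, p_both)]"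
    using assms by (auto simp: pmf_of_list_wf_def)
  from set_pmf_of_list[OF this] show ?thesis
    by (auto simp: Dyck_N_step_pmf_def Dyck_N_steps_def)
qed

lemma prob_Dyck_N_excursion_eq:
  assumes "0 \<le> p_minus" "0 \<le> p_plus" "0 \<le> p_both" "p_minus + p_plus + p_both = 1"
  shows "prob_Dyck_N_excursion p_minus p_plus p_both (2 * n) = excursion_weight p_minus p_plus n"
  unfolding prob_Dyck_N_excursion_def excursion_weight_def passage_weight_def
    prob_Dyck_N_excursion_passage[OF set_Dyck_N_step_pmf[OF assms]] pmf_Dyck_N_step_pmf[OF assms]
  using assms by (subst (1 2 3 4) passage_prob_catalan) auto

text \<open>A Catalan convolution identity, obtained by computing one probability in two
  ways.\<close>

lemma excursion_weight_deterministic: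
  assumes "0 < a" "0 \<le> b" "a + b = 1"
  shows "excursion_weight a b n = catalan_weight n * (4 * a * (1 - a)) ^ n"
proof -
  have ab: "0 \<le> a" "0 \<le> b" "0 \<le> (0::real)" "a + b + 0 = 1" using assms by auto
  let ?p = "Dyck_N_step_pmf a b 0"
  have "{-1, 1} \<notin> set_pmf ?p"
    using pmf_Dyck_N_step_pmf(3)[OF ab] by (simp add: set_pmf_iff)
  with set_Dyck_N_step_pmf[OF ab] have "set_pmf ?p \<subseteq> {{-1}, {1}}"
    by (auto simp: Dyck_N_steps_def)
  from prob_Dyck_N_excursion_deterministic[OF this] show ?thesis
    using \<open>0 < a\<close> prob_Dyck_N_excursion_eq[OF ab, of n]
    by (simp add: prob_Dyck_N_excursion_def pmf_Dyck_N_step_pmf[OF ab])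
qed

lemma excursion_weight_tails:
  assumes "0 \<le> a" "a \<le> 1" "0 \<le> b" "b \<le> 1"
    and "A = (if a \<le> 1/2 then a / (1 - a) else 1)" "B = (if b \<le> 1/2 then b / (1 - b) else 1)"
  shows "excursion_weight a b n = (1 - A) * (1 - B) + (1 - A) * passage_tail b n +
    passage_tail a n -
    (\<Sum>j<n. passage_weight b j * passage_tail a (n - j))"
  unfolding excursion_weight_def passage_weight_def passage_tail_def
  by (rule inclusion_exclusion_tails) (unfold assms(5,6), (rule passage_sums; fact)+)

section \<open>Tails of the passage series away from \<open>q = 1/2\<close>\<close>

definition catalan_tail :: "real \<Rightarrow> nat \<Rightarrow> real" where
  "catalan_tail x n = (\<Sum>k. x ^ k * catalan_weight (n + k))"

lemma catalan_weight_le_decreasing: "catalan_weight (n + k) \<le> catalan_weight n"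
  by (induction k) (auto intro: order_trans catalan_weight_decreasing)

lemma summable_catalan_tail:
  assumes "0 \<le> x" "x < 1"
  shows "summable (\<lambda>k. x ^ k * catalan_weight (n + k))"
proof (rule summable_comparison_test'[of "\<lambda>k. x ^ k * catalan_weight n" 0])
  show "summable (\<lambda>k. x ^ k * catalan_weight n)"
    using assms by (intro summable_mult2 summable_geometric) simp
  fix k show "norm (x ^ k * catalan_weight (n + k)) \<le> x ^ k * catalan_weight n"
    using assms catalan_weight_le_decreasing[of n k]
    by (simp add: abs_mult less_imp_le catalan_weight_pos mult_left_mono)
qed

lemma catalan_tail_bounds:
  assumes "0 \<le> x" "x < 1"
  shows "0 \<le> catalan_tail x n" and "catalan_tail x n \<le> real (n + 1) powr (-3/2) / (1 - x)"
proof -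
  show "0 \<le> catalan_tail x n"
    unfolding catalan_tail_def using assms
    by (intro suminf_nonneg summable_catalan_tail) (simp_all add: less_imp_le catalan_weight_pos)
  have "catalan_tail x n \<le> (\<Sum>k. x ^ k * catalan_weight n)"
    unfolding catalan_tail_def using assms
    by (intro suminf_le summable_catalan_tail summable_mult2 summable_geometric mult_left_mono
        catalan_weight_le_decreasing) auto
  also have "\<dots> = catalan_weight n / (1 - x)"
    using assms suminf_mult2[OF summable_geometric[of x], of "catalan_weight n"]
    by (simp add: suminf_geometric)
  also have "\<dots> \<le> real (n + 1) powr (-3/2) / (1 - x)"
    using assms by (intro divide_right_mono catalan_weight_le) auto
  finally show "catalan_tail x n \<le> real (n + 1) powr (-3/2) / (1 - x)" .
qed

lemma catalan_tail_diff_le: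
  assumes "0 \<le> x" "x < 1"
  shows "\<bar>catalan_tail x n - catalan_tail x (Suc n)\<bar> \<le> 2 / (1 - x) * real (n + 1) powr (-5/2)"
proof -
  let ?d = "\<lambda>k. x ^ k * (catalan_weight (n + k) - catalan_weight (Suc n + k))"
  have le: "\<bar>?d k\<bar> \<le> x ^ k * (2 * real (n + 1) powr (-5/2))" for k
  proof -
    have "\<bar>catalan_weight (n + k) - catalan_weight (Suc n + k)\<bar> \<le> 2 * real (n + k + 1) powr (-5/2)"
      using catalan_weight_diff_le[of "n + k"] by simp
    also have "\<dots> \<le> 2 * real (n + 1) powr (-5/2)"
      by (intro mult_left_mono powr_mono2') auto
    finally show ?thesis
      using assms by (simp add: abs_mult mult_left_mono)
  qed
  have sg: "summable (\<lambda>k. x ^ k * (2 * real (n + 1) powr (-5/2)))"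
    using assms by (intro summable_mult2 summable_geometric) simp
  have sd: "summable (\<lambda>k. \<bar>?d k\<bar>)"
    by (rule summable_comparison_test'[OF sg, of 0]) (use le in simp)
  have "catalan_tail x n - catalan_tail x (Suc n) = (\<Sum>k. ?d k)"
    unfolding catalan_tail_def
    using suminf_diff[OF summable_catalan_tail[OF assms, of n] summable_catalan_tail[OF assms, of "Suc n"]]
    by (simp add: right_diff_distrib)
  also have "\<bar>\<dots>\<bar> \<le> (\<Sum>k. \<bar>?d k\<bar>)" by (rule summable_rabs[OF sd])
  also have "\<dots> \<le> (\<Sum>k. x ^ k * (2 * real (n + 1) powr (-5/2)))"
    by (rule suminf_le[OF le sd sg])
  also have "\<dots> = 2 / (1 - x) * real (n + 1) powr (-5/2)"
    using assms suminf_mult2[OF summable_geometric[of x], of "2 * real (n + 1) powr (-5/2)"]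
    by (simp add: suminf_geometric)
  finally show ?thesis .
qed

text \<open>Against the geometric factor the Catalan weights are nearly constant, so the sum is the
  first weight times a geometric series.\<close>

lemma catalan_tail_asymp:
  assumes "0 \<le> x" "x < 1"
  shows "(\<lambda>n. catalan_tail x n - 1 / (1 - x) * catalan_weight n) \<in> O(\<lambda>n. real n powr (-5/2))"
proof -
  have "(\<lambda>n. (\<Sum>k. x ^ k * catalan_weight (n + k)) - (\<Sum>k. x ^ k) * catalan_weight n) \<in>
      O(\<lambda>n. real n powr (-(5/2)))"
  proof (rule shifted_sum_asymp(1)[where K = 2])
    show "summable (\<lambda>k. \<bar>x ^ k\<bar> * real (k + 1) ^ 4)"
      using summable_geometric_times_power[OF assms] assms(1) by (simp only: abs_of_nonneg zero_le_power)
    fix n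
    show "\<bar>catalan_weight n - catalan_weight (Suc n)\<bar> \<le> 2 * real (n + 1) powr (-(5/2))"
      using catalan_weight_diff_le[of n] by simp
  qed simp
  then show ?thesis using assms by (simp add: catalan_tail_def suminf_geometric)
qed

text \<open>Splits off the exponential decay; the remaining \<open>catalan_tail\<close> varies only
  polynomially, as the convolution estimates require.\<close>

lemma passage_tail_eq:
  assumes "0 \<le> q" "q \<le> 1" "q \<noteq> 1/2"
  shows "passage_tail q n = q * (4 * q * (1 - q)) ^ n * catalan_tail (4 * q * (1 - q)) n"
proof -
  have "summable (\<lambda>k. (4 * q * (1 - q)) ^ k * catalan_weight (n + k))"
    using assms by (intro summable_catalan_tail) (auto simp: four_mult_less_one)
  from suminf_mult[OF this, of "q * (4 * q * (1 - q)) ^ n"]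
  show ?thesis
    unfolding passage_tail_def passage_weight_def catalan_tail_def
    by (simp only: power_add mult_ac add.commute[of _ n])
qed

text \<open>Only upper bounds on the corrections are needed. As \<open>a = b\<close> is allowed, the
  two series may share the rate \<open>x\<close> and neither dominates the other, so the convolution
  is bounded by \<open>convolution_powr_bound\<close> instead of being expanded.\<close>

lemma excursion_weight_subcritical:
  assumes "0 \<le> b" "b \<le> a" "a < 1/2"
  shows "(\<lambda>n. excursion_weight a b n - (1 - 2 * b) * (1 - 2 * a) / ((1 - b) * (1 - a)))
    \<in> O(\<lambda>n. (4 * a * (1 - a)) ^ n / real n powr (3/2))"
proof -
  define x y where "x = 4 * a * (1 - a)" and "y = 4 * b * (1 - b)"
  have "0 \<le> (a - b) * (1 - a - b)" using assms by simp
  then have "y \<le> x" by (simp add: x_def y_def algebra_simps)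
  moreover have "0 \<le> y" "x < 1"
    using assms four_mult_less_one[of a] by (auto simp: x_def y_def)
  ultimately have xy: "0 \<le> y" "0 \<le> x" "y \<le> x" "x < 1" "y < 1" by auto
  obtain C where C: "\<And>n. (\<Sum>j<n. real (j + 1) powr (-3/2) * real (n - j + 1) powr (-3/2)) \<le>
      C * real (n + 1) powr (-3/2)"
    using convolution_powr_bound by blast
  define A where "A = a / (1 - a)"
  define D where "D = 1 / (1 - x)"
  have D: "0 < D" using xy by (simp add: D_def)
  have A: "0 \<le> 1 - A" "1 - A \<le> 1" using assms by (auto simp: A_def field_simps)
  have weight: "0 \<le> passage_weight b j \<and> passage_weight b j \<le> x ^ j * real (j + 1) powr (-3/2)" for j
  proof -
    have "b * catalan_weight j * y ^ j \<le> 1 * real (j + 1) powr (-3/2) * x ^ j"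
      using assms xy
      by (intro mult_mono catalan_weight_le power_mono) (auto simp: less_imp_le catalan_weight_pos)
    then show ?thesis
      using assms xy unfolding passage_weight_def y_def[symmetric]
      by (simp add: less_imp_le catalan_weight_pos mult_ac)
  qed
  have tail_a: "0 \<le> passage_tail a n \<and>
      passage_tail a n \<le> D * (x ^ n * real (n + 1) powr (-3/2))" for n
  proof -
    have eq: "passage_tail a n = a * x ^ n * catalan_tail x n"
      unfolding x_def by (rule passage_tail_eq) (use assms in auto)
    have "a * x ^ n * catalan_tail x n \<le> 1 * x ^ n * (real (n + 1) powr (-3/2) / (1 - x))"
      using assms xy by (intro mult_mono catalan_tail_bounds) auto
    then show ?thesis
      using assms xy catalan_tail_bounds(1)[of x n] by (simp add: eq D_def)
  qed
  have tail_b: "0 \<le> passage_tail b n \<and>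
      passage_tail b n \<le> D * (x ^ n * real (n + 1) powr (-3/2))" for n
  proof -
    have eq: "passage_tail b n = b * y ^ n * catalan_tail y n"
      unfolding y_def by (rule passage_tail_eq) (use assms in auto)
    have "b * y ^ n * catalan_tail y n \<le> 1 * x ^ n * (real (n + 1) powr (-3/2) / (1 - x))"
    proof (intro mult_mono power_mono)
      have "catalan_tail y n \<le> real (n + 1) powr (-3/2) / (1 - y)"
        using xy by (intro catalan_tail_bounds)
      also have "\<dots> \<le> real (n + 1) powr (-3/2) / (1 - x)"
        using xy by (intro divide_left_mono) auto
      finally show "catalan_tail y n \<le> real (n + 1) powr (-3/2) / (1 - x)" .
    qed (use assms xy catalan_tail_bounds(1)[of y n] in auto)
    then show ?thesis
      using assms xy catalan_tail_bounds(1)[of y n] by (simp add: eq D_def)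
  qed
  have conv: "0 \<le> (\<Sum>j<n. passage_weight b j * passage_tail a (n - j)) \<and>
      (\<Sum>j<n. passage_weight b j * passage_tail a (n - j)) \<le>
        D * C * (x ^ n * real (n + 1) powr (-3/2))" for n
  proof
    show "0 \<le> (\<Sum>j<n. passage_weight b j * passage_tail a (n - j))"
      by (intro sum_nonneg mult_nonneg_nonneg conjunct1[OF weight] conjunct1[OF tail_a])
    have "(\<Sum>j<n. passage_weight b j * passage_tail a (n - j)) \<le>
        (\<Sum>j<n. (x ^ j * real (j + 1) powr (-3/2)) *
          (D * (x ^ (n - j) * real (n - j + 1) powr (-3/2))))"
      using xy
      by (intro sum_mono mult_mono conjunct1[OF tail_a] conjunct2[OF tail_a] conjunct2[OF weight])
        simp_all
    also have "\<dots> = (\<Sum>j<n. D * x ^ n * (real (j + 1) powr (-3/2) * real (n - j + 1) powr (-3/2)))"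
    proof (rule sum.cong)
      fix j assume "j \<in> {..<n}"
      then have eq: "x ^ n = x ^ j * x ^ (n - j)"
        using power_add[of x j "n - j"] by simp
      show "(x ^ j * real (j + 1) powr (-3/2)) * (D * (x ^ (n - j) * real (n - j + 1) powr (-3/2))) =
          D * x ^ n * (real (j + 1) powr (-3/2) * real (n - j + 1) powr (-3/2))"
        unfolding eq by (simp only: mult_ac)
    qed simp
    also have "\<dots> = D * x ^ n * (\<Sum>j<n. real (j + 1) powr (-3/2) * real (n - j + 1) powr (-3/2))"
      by (rule sum_distrib_left[symmetric])
    also have "\<dots> \<le> D * x ^ n * (C * real (n + 1) powr (-3/2))"
      using D xy by (intro mult_left_mono C) simp
    finally show "(\<Sum>j<n. passage_weight b j * passage_tail a (n - j)) \<le>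
        D * C * (x ^ n * real (n + 1) powr (-3/2))" by (simp only: mult_ac)
  qed
  have "\<bar>excursion_weight a b n - (1 - 2 * b) * (1 - 2 * a) / ((1 - b) * (1 - a))\<bar> \<le>
      (2 * D + D * C) * (x ^ n * real (n + 1) powr (-3/2))" for n
  proof -
    have "(1 - A) * (1 - b / (1 - b)) = (1 - 2 * b) * (1 - 2 * a) / ((1 - b) * (1 - a))"
      using assms by (simp add: A_def divide_simps)
    moreover have "excursion_weight a b n = (1 - A) * (1 - b / (1 - b)) +
        (1 - A) * passage_tail b n + passage_tail a n -
        (\<Sum>j<n. passage_weight b j * passage_tail a (n - j))"
      by (rule excursion_weight_tails) (use assms in \<open>auto simp: A_def\<close>)
    moreover have "(1 - A) * passage_tail b n \<le> 1 * (D * (x ^ n * real (n + 1) powr (-3/2)))"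
      using A tail_b[of n] by (intro mult_mono) auto
    moreover have "0 \<le> (1 - A) * passage_tail b n"
      using A tail_b[of n] by simp
    ultimately show ?thesis
      using tail_a[of n] conv[of n] unfolding distrib_right by linarith
  qed
  moreover have "0 \<le> C"
    using C[of 0] by simp
  ultimately have "norm (excursion_weight a b n - (1 - 2 * b) * (1 - 2 * a) / ((1 - b) * (1 - a))) \<le>
      (2 * D + D * C) * norm (x ^ n / real n powr (3/2))" if "0 < n" for n
  proof -
    have "real (n + 1) powr (-3/2) \<le> real n powr (-3/2)"
      using that by (intro powr_mono2') auto
    then have "(2 * D + D * C) * (x ^ n * real (n + 1) powr (-3/2)) \<le>
        (2 * D + D * C) * (x ^ n * real n powr (-3/2))"
      using D xy \<open>0 \<le> C\<close> by (intro mult_left_mono) auto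
    then show ?thesis
      using \<open>\<bar>_ - _\<bar> \<le> _\<close>[of n] xy by (simp add: powr_minus_divide)
  qed
  then show ?thesis
    unfolding x_def
    by (intro bigoI[of _ "2 * D + D * C"] eventually_mono[OF eventually_gt_at_top[of 0]])
qed

text \<open>The classical fact that the symmetric walk stays nonnegative up to time
  \<open>2 * n\<close> as often as it is at 0 at that time.\<close>

lemma passage_tail_half: "passage_tail (1/2) n = central_binomial_weight n"
proof -
  have "(\<lambda>i. central_binomial_weight (i + n) - central_binomial_weight (Suc i + n)) sums
      (central_binomial_weight (0 + n) - 0)"
    by (rule telescope_sums'[OF LIMSEQ_ignore_initial_segment[OF central_binomial_weight_tendsto_0]])
  moreover have "passage_weight (1/2) (i + n) =
      central_binomial_weight (i + n) - central_binomial_weight (Suc i + n)" for i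
    by (simp add: passage_weight_def catalan_weight_telescope)
  ultimately show ?thesis by (simp add: passage_tail_def sums_iff)
qed

lemma summable_catalan_weight_geometric:
  assumes "0 \<le> x" "x < 1" "0 \<le> c"
  shows "summable (\<lambda>j. \<bar>c * catalan_weight j * x ^ j\<bar> * real (j + 1) ^ 4)"
proof (rule summable_comparison_test'[OF summable_mult[OF summable_geometric_times_power[OF assms(1,2)], of c], of 0])
  fix j
  have "catalan_weight j \<le> 1" using catalan_weight_le_decreasing[of 0 j] by simp
  then have "c * catalan_weight j * x ^ j * real (j + 1) ^ 4 \<le> c * 1 * x ^ j * real (j + 1) ^ 4"
    using assms by (intro mult_right_mono mult_left_mono) auto
  then show "norm (\<bar>c * catalan_weight j * x ^ j\<bar> * real (j + 1) ^ 4) \<le> c * (x ^ j * real (j + 1) ^ 4)"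
    using assms catalan_weight_pos[of j] by (simp add: abs_mult mult_ac)
qed

lemma bigo_cmult:
  fixes f g :: "'a \<Rightarrow> real"
  assumes "f \<in> O[F](g)"
  shows "(\<lambda>x. c * f x) \<in> O[F](g)"
  using assms by (cases "c = 0") simp_all

text \<open>Since \<open>A = 1\<close>, only the tail and its convolution with the
  \<open>b\<close>-weights remain. These decay geometrically, which leaves the tail times
  \<open>1 - B = (1 - 2 * b) / (1 - b)\<close>.\<close>

lemma excursion_weight_critical:
  assumes "0 \<le> b" "b < 1/2"
  shows "(\<lambda>n. excursion_weight (1/2) b n - (1 - 2 * b) / ((1 - b) * sqrt (pi * real n)))
    \<in> O(\<lambda>n. real n powr (-3/2))"
proof -
  define B where "B = b / (1 - b)"
  have b: "(\<Sum>j. passage_weight b j) = B"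
    using passage_sums[of b] assms by (simp add: passage_weight_def sums_iff B_def)
  have "(\<lambda>n. (\<Sum>j<n. passage_weight b j * central_binomial_weight (n - j)) -
      (\<Sum>j. passage_weight b j) * central_binomial_weight n) \<in> O(\<lambda>n. real n powr (-(3/2)))"
  proof (rule convolution_asymp[where K = 1])
    show "summable (\<lambda>j. \<bar>passage_weight b j\<bar> * real (j + 1) ^ 4)"
      unfolding passage_weight_def
      by (rule summable_catalan_weight_geometric) (use assms four_mult_less_one[of b] in auto)
    fix n
    have "\<bar>central_binomial_weight n - central_binomial_weight (Suc n)\<bar> = catalan_weight n / 2"
      using catalan_weight_pos[of n] by (simp add: catalan_weight_telescope)
    also have "\<dots> \<le> catalan_weight n" using catalan_weight_pos[of n] by simp
    also have "\<dots> \<le> real (n + 1) powr (-3/2)" by (rule catalan_weight_le)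
    finally show "\<bar>central_binomial_weight n - central_binomial_weight (Suc n)\<bar> \<le> 1 * real (n + 1) powr (-(3/2))"
      by simp
    show "\<bar>central_binomial_weight n\<bar> \<le> 1 * real (n + 1) powr (1 - 3/2)"
      using central_binomial_weight_le[of n] central_binomial_weight_pos[of n]
      by (simp add: powr_minus_divide powr_half_sqrt)
  qed auto
  then have conv: "(\<lambda>n. (\<Sum>j<n. passage_weight b j * central_binomial_weight (n - j)) -
      B * central_binomial_weight n) \<in> O(\<lambda>n. real n powr (-3/2))"
    by (simp add: b)
  have asymp: "(\<lambda>n. (1 - B) * (central_binomial_weight n - 1 / sqrt (pi * real n))) \<in> O(\<lambda>n. real n powr (-3/2))"
    by (intro bigo_cmult central_binomial_weight_asymp)
  have "excursion_weight (1/2) b n - (1 - 2 * b) / ((1 - b) * sqrt (pi * real n)) =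
      (1 - B) * (central_binomial_weight n - 1 / sqrt (pi * real n)) -
      ((\<Sum>j<n. passage_weight b j * central_binomial_weight (n - j)) - B * central_binomial_weight n)" for n
  proof -
    have "excursion_weight (1/2) b n = central_binomial_weight n -
        (\<Sum>j<n. passage_weight b j * central_binomial_weight (n - j))"
      using excursion_weight_tails[of "1/2" b 1 B n] assms by (simp add: passage_tail_half B_def)
    moreover have "(1 - 2 * b) / ((1 - b) * sqrt (pi * real n)) = (1 - B) * (1 / sqrt (pi * real n))"
      using assms by (simp add: B_def divide_simps)
    ultimately show ?thesis by (simp add: algebra_simps)
  qed
  then show ?thesis using sum_in_bigo(2)[OF asymp conv] by simp
qed

text \<open>Once \<open>x ^ n\<close> is taken out of tail and convolution, the
  \<open>b\<close>-weights carry \<open>z ^ j\<close> with \<open>z\<close> the ratio of the two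
  rates; \<open>a + b < 1\<close> gives \<open>z < 1\<close>. The constant contains the Catalan
  series at \<open>z\<close>.\<close>

lemma excursion_weight_supercritical_asymp:
  assumes "0 \<le> b" "b < 1/2" "1/2 < a" "a < 1" "a + b < 1"
  defines "x \<equiv> 4 * a * (1 - a)" and "z \<equiv> b * (1 - b) / (a * (1 - a))"
  shows "(\<lambda>n. excursion_weight a b n -
      a * (1 - 2 * b / (1 + sqrt (1 - z))) / (1 - x) / sqrt pi * (x ^ n / sqrt (real n ^ 3)))
    \<in> O(\<lambda>n. x ^ n / real n powr (5/2))"
proof -
  let ?T = "catalan_tail x"
  define B where "B = 2 * b / (1 + sqrt (1 - z))"
  have x: "0 < x" "x < 1"
    using assms four_mult_less_one[of a] by (auto simp: x_def)
  have "b * (1 - b) < a * (1 - a)"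
  proof -
    have "0 < (a - b) * (1 - a - b)" using assms by simp
    then show ?thesis by (simp add: algebra_simps)
  qed
  then have z: "0 \<le> z" "z < 1" using assms by (auto simp: z_def)
  have weight: "passage_weight b j = b * catalan_weight j * z ^ j * x ^ j" for j
  proof -
    have "z * (a * (1 - a)) = b * (1 - b)" using assms(3,4) by (simp add: z_def)
    then have "4 * b * (1 - b) = z * x" by (simp only: x_def mult.assoc mult.left_commute)
    then show ?thesis by (simp add: passage_weight_def power_mult_distrib)
  qed
  have exact: "excursion_weight a b n = x ^ n * (a * (?T n - (\<Sum>j<n. b * catalan_weight j * z ^ j * ?T (n - j))))" for n
  proof -
    have tail: "passage_tail a n = a * x ^ n * ?T n" for n
      unfolding x_def by (rule passage_tail_eq) (use assms in auto)
    have "excursion_weight a b n = passage_tail a n - (\<Sum>j<n. passage_weight b j * passage_tail a (n - j))"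
      using excursion_weight_tails[of a b 1 "b / (1 - b)" n] assms by simp
    also have "(\<Sum>j<n. passage_weight b j * passage_tail a (n - j)) =
        (\<Sum>j<n. a * x ^ n * (b * catalan_weight j * z ^ j * ?T (n - j)))"
    proof (rule sum.cong)
      fix j assume "j \<in> {..<n}"
      then have eq: "x ^ n = x ^ j * x ^ (n - j)"
        using power_add[of x j "n - j"] by simp
      show "passage_weight b j * passage_tail a (n - j) =
          a * x ^ n * (b * catalan_weight j * z ^ j * ?T (n - j))"
        unfolding weight tail eq by (simp only: mult_ac)
    qed simp
    finally show ?thesis
      by (simp only: tail right_diff_distrib sum_distrib_left mult_ac)
  qed
  have "(\<lambda>n. (\<Sum>j<n. b * catalan_weight j * z ^ j * ?T (n - j)) -
      (\<Sum>j. b * catalan_weight j * z ^ j) * ?T n) \<in> O(\<lambda>n. real n powr (-(5/2)))"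
  proof (rule convolution_asymp[where K = "2 / (1 - x)"])
    show "summable (\<lambda>j. \<bar>b * catalan_weight j * z ^ j\<bar> * real (j + 1) ^ 4)"
      by (rule summable_catalan_weight_geometric) (use z assms in auto)
    fix n
    show "\<bar>?T n - ?T (Suc n)\<bar> \<le> 2 / (1 - x) * real (n + 1) powr (-(5/2))"
      using catalan_tail_diff_le[of x n] x by simp
    have "?T n \<le> 2 * (real (n + 1) powr (-3/2) / (1 - x))"
      using catalan_tail_bounds[of x n] x by linarith
    then show "\<bar>?T n\<bar> \<le> 2 / (1 - x) * real (n + 1) powr (1 - 5/2)"
      using catalan_tail_bounds(1)[of x n] x by simp
  qed auto
  moreover have "(\<Sum>j. b * catalan_weight j * z ^ j) = B"
    using sums_mult[OF catalan_weight_sums[of z], of b] z by (simp add: sums_iff B_def mult_ac)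
  ultimately have conv: "(\<lambda>n. (\<Sum>j<n. b * catalan_weight j * z ^ j * ?T (n - j)) - B * ?T n) \<in> O(\<lambda>n. real n powr (-5/2))"
    by simp
  have T: "(\<lambda>n. (1 - B) * (?T n - 1 / (1 - x) * catalan_weight n)) \<in> O(\<lambda>n. real n powr (-5/2))"
    using x by (intro bigo_cmult catalan_tail_asymp) auto
  have r: "(\<lambda>n. (1 - B) / (1 - x) * (catalan_weight n - 1 / sqrt (pi * real n ^ 3))) \<in> O(\<lambda>n. real n powr (-5/2))"
    by (intro bigo_cmult catalan_weight_asymp)
  \<comment> \<open>\<open>E\<close> collects the errors of three replacements: the convolution by
    \<open>B * ?T n\<close>, the tail by a multiple of the Catalan weight, and that weight by its
    leading term.\<close>
  define E where "E = (\<lambda>n. (1 - B) * (?T n - 1 / (1 - x) * catalan_weight n) +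
      (1 - B) / (1 - x) * (catalan_weight n - 1 / sqrt (pi * real n ^ 3)) -
      ((\<Sum>j<n. b * catalan_weight j * z ^ j * ?T (n - j)) - B * ?T n))"
  have "E \<in> O(\<lambda>n. real n powr (-5/2))"
    unfolding E_def by (intro sum_in_bigo T r conv)
  then have "(\<lambda>n. x ^ n * (a * E n)) \<in> O(\<lambda>n. x ^ n * real n powr (-5/2))"
    by (intro landau_o.big.mult landau_o.big_refl bigo_cmult)
  moreover have "excursion_weight a b n - a * (1 - B) / (1 - x) / sqrt pi * (x ^ n / sqrt (real n ^ 3)) =
      x ^ n * (a * E n)" for n
    unfolding exact E_def by (simp add: algebra_simps real_sqrt_mult diff_divide_distrib)
  ultimately show ?thesis by (simp add: B_def powr_minus_divide)
qed

text \<open>As \<open>c = 1 - a - b\<close>, the radicand is \<open>w ^ 2 * (1 - z)\<close> with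
  \<open>w = a * (1 - a)\<close>. Rationalising gives
  \<open>w * (1 - s) = b * (1 - b) / (1 + s)\<close>, after which \<open>1 - b\<close>
  cancels.\<close>

lemma Dyck_N_gamma_eq:
  assumes "0 \<le> b" "b < 1/2" "1/2 < a" "a < 1" "a + b < 1" "a + b + c = 1"
  defines "z \<equiv> b * (1 - b) / (a * (1 - a))"
  shows "Dyck_N_gamma a b c = a * (1 - 2 * b / (1 + sqrt (1 - z))) / (1 - 4 * a * (1 - a)) / sqrt pi"
proof -
  define s where "s = sqrt (1 - z)"
  define w where "w = a * (1 - a)"
  have w: "0 < w" using assms by (simp add: w_def)
  have disc: "c * a * (1 - a) * (a - b) = w * (w - b * (1 - b))"
  proof -
    have c: "c = 1 - a - b" using assms by simp
    show ?thesis unfolding c w_def by (simp add: algebra_simps)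
  qed
  have "0 \<le> w - b * (1 - b)"
  proof -
    have "0 \<le> (a - b) * (1 - a - b)" using assms by simp
    then show ?thesis by (simp add: w_def algebra_simps)
  qed
  moreover have z_w: "z = b * (1 - b) / w" by (simp add: z_def w_def)
  ultimately have z: "z \<le> 1" using w by simp
  have "c * a * (1 - a) * (a - b) = w ^ 2 * (1 - z)"
    unfolding disc z_w using w by (simp add: power2_eq_square field_simps)
  then have S: "sqrt (c * a * (1 - a) * (a - b)) = w * s"
    using w by (simp add: s_def real_sqrt_mult)
  have s: "0 \<le> s" "s ^ 2 = 1 - z" using z by (simp_all add: s_def)
  have "w * (1 - s) * (1 + s) = b * (1 - b)"
  proof -
    have "w * (1 - s) * (1 + s) = w * (1 - s ^ 2)" by (simp add: power2_eq_square algebra_simps)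
    also have "\<dots> = b * (1 - b)" using w s by (simp add: z_def w_def[symmetric])
    finally show ?thesis .
  qed
  then have "w * (1 - s) = b * (1 - b) / (1 + s)"
    using s by (simp add: field_simps)
  then have main: "2 * (w * s - w + (1 - b) / 2) / (1 - b) = 1 - 2 * b / (1 + s)"
    using assms s by (simp add: field_simps)
  have square: "(2 * a - 1)\<^sup>2 = 1 - 4 * a * (1 - a)"
    by (simp add: power2_eq_square algebra_simps)
  have "Dyck_N_gamma a b c =
      2 * a / sqrt pi * ((w * s - w + (1 - b) / 2) / ((1 - b) * (2 * a - 1)\<^sup>2))"
    using assms unfolding Dyck_N_gamma_def S by (simp add: w_def)
  also have "\<dots> = a * (2 * (w * s - w + (1 - b) / 2) / (1 - b)) / (2 * a - 1)\<^sup>2 / sqrt pi"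
    by (simp only: times_divide_eq_left times_divide_eq_right divide_divide_eq_left mult_ac)
  finally show ?thesis unfolding main square unfolding s_def .
qed

text \<open>The constant jumps at \<open>c = 0\<close>: there the generic formula would give
  \<open>a / ((2 * a - 1) * sqrt pi)\<close>. This is the case \<open>z = 1\<close>, where the
  \<open>b\<close>-weights lose their geometric decay.\<close>

lemma excursion_weight_supercritical:
  assumes "0 \<le> b" "b < 1/2" "1/2 < a" "a < 1" "0 \<le> c" "a + b + c = 1"
  shows "(\<lambda>n. excursion_weight a b n - Dyck_N_gamma a b c * ((4 * a * (1 - a)) ^ n / sqrt (real n ^ 3)))
    \<in> O(\<lambda>n. (4 * a * (1 - a)) ^ n / real n powr (5/2))"
proof (cases "c = 0")
  case True
  let ?x = "4 * a * (1 - a)"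
  have "(\<lambda>n. ?x ^ n * (catalan_weight n - 1 / sqrt (pi * real n ^ 3))) \<in>
      O(\<lambda>n. ?x ^ n * real n powr (-5/2))"
    by (intro landau_o.big.mult landau_o.big_refl catalan_weight_asymp)
  then show ?thesis
    using assms True
    by (simp add: excursion_weight_deterministic Dyck_N_gamma_def real_sqrt_mult powr_minus_divide
        algebra_simps)
next
  case False
  then show ?thesis
    using excursion_weight_supercritical_asymp[of b a] Dyck_N_gamma_eq[of b a c] assms by simp
qed

theorem theorem2p14:
  fixes p_minus p_plus p_both a b :: real
  assumes "p_minus \<ge> 0" and "p_plus \<ge> 0" and "p_both \<ge> 0"
    and "p_minus + p_plus + p_both = 1"
    and "(a, b) = (p_minus, p_plus) \<or> (a, b) = (p_plus, p_minus)"
  shows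
    "(0 \<le> b \<and> b \<le> a \<and> a < 1/2 \<longrightarrow>
       (\<lambda>n. prob_Dyck_N_excursion p_minus p_plus p_both (2 * n)
             - (1 - 2 * b) * (1 - 2 * a) / ((1 - b) * (1 - a)))
       \<in> O(\<lambda>n. (4 * a * (1 - a)) ^ n / real n powr (3/2))) \<and>
     (0 \<le> b \<and> b < 1/2 \<and> a = 1/2 \<longrightarrow>
       (\<lambda>n. prob_Dyck_N_excursion p_minus p_plus p_both (2 * n)
             - (1 - 2 * b) / ((1 - b) * sqrt (pi * real n)))
       \<in> O(\<lambda>n. real n powr (-3/2))) \<and>
     (b = 1/2 \<and> a = 1/2 \<longrightarrow>
       (\<lambda>n. prob_Dyck_N_excursion p_minus p_plus p_both (2 * n)
             - 1 / sqrt (pi * real n ^ 3))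
       \<in> O(\<lambda>n. real n powr (-5/2))) \<and>
     (0 \<le> b \<and> b < 1/2 \<and> 1/2 < a \<and> a < 1 \<and> a + b \<le> 1 \<longrightarrow>
       (\<lambda>n. prob_Dyck_N_excursion p_minus p_plus p_both (2 * n)
             - Dyck_N_gamma a b p_both * ((4 * a * (1 - a)) ^ n / sqrt (real n ^ 3)))
       \<in> O(\<lambda>n. (4 * a * (1 - a)) ^ n / real n powr (5/2)))"
proof -
  have prob: "prob_Dyck_N_excursion p_minus p_plus p_both (2 * n) = excursion_weight a b n" for n
    using assms(5) prob_Dyck_N_excursion_eq[OF assms(1-4)] excursion_weight_commute by auto
  have sum: "a + b + p_both = 1" using assms(4,5) by auto
  show ?thesis
    unfolding prob
  proof (intro conjI impI; elim conjE)
    assume "0 \<le> b" "b \<le> a" "a < 1/2"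
    then show "(\<lambda>n. excursion_weight a b n - (1 - 2 * b) * (1 - 2 * a) / ((1 - b) * (1 - a)))
        \<in> O(\<lambda>n. (4 * a * (1 - a)) ^ n / real n powr (3/2))"
      by (rule excursion_weight_subcritical)
  next
    assume "0 \<le> b" "b < 1/2" "a = 1/2"
    then show "(\<lambda>n. excursion_weight a b n - (1 - 2 * b) / ((1 - b) * sqrt (pi * real n)))
        \<in> O(\<lambda>n. real n powr (-3/2))"
      using excursion_weight_critical[of b] by (simp only:)
  next
    \<comment> \<open>Expanding the convolution would give the leading factor
      \<open>1 - B = 0\<close>, so the exact formula is used.\<close>
    assume half: "b = 1/2" "a = 1/2"
    have "excursion_weight a b n = catalan_weight n" for n
      unfolding half using excursion_weight_deterministic[of "1/2" "1/2" n] by simp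
    then show "(\<lambda>n. excursion_weight a b n - 1 / sqrt (pi * real n ^ 3)) \<in> O(\<lambda>n. real n powr (-5/2))"
      using catalan_weight_asymp by (simp only:)
  next
    assume "0 \<le> b" "b < 1/2" "1/2 < a" "a < 1"
    then show "(\<lambda>n. excursion_weight a b n - Dyck_N_gamma a b p_both * ((4 * a * (1 - a)) ^ n / sqrt (real n ^ 3)))
        \<in> O(\<lambda>n. (4 * a * (1 - a)) ^ n / real n powr (5/2))"
      using assms(3) sum by (rule excursion_weight_supercritical)
  qed
qed

end
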